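(* Let $n \geq 2$ and let $u_1, u_2, u_3, \ldots$ be an infinite sequence of unitaries in $\mathcal{U}(\mathcal{F}_n^1) \simeq U(n)$. Let $\alpha_{\underline{u}} = \bigotimes_{i=1}^\infty \mathrm{Ad}(u_i)$ be the associated product automorphism of $\mathcal{F}_n \simeq \bigotimes_{i=1}^\infty M_n$. (1) If the norm limit $$v := \lim_{k \to \infty} u_1 \otimes u_2 u_1^* \otimes u_3 u_2^* \otimes \cdots \otimes u_{k+1}u_k^* \otimes 1 \otimes 1 \otimes \cdots$$ exists in $\bigotimes_{i=1}^\infty M_n$ (and thus defines a unitary $v \in \mathcal{F}_n$), then $\lambda_v$ is an automorphism of $\mathcal{O}_n$ whose restriction to $\mathcal{F}_n$ coincides with $\alpha_{\underline{u}}$. (2) Conversely, suppose that $\alpha_{\underline{u}}$ extends to an endomorphism of $\mathcal{O}_n$. Then there are real numbers $(\theta_k)_{k \geq 1}$ such that, with $u'_k = e^{i\theta_k} u_k$, the norm limit $$\lim_{k \to \infty} u'_1 \otimes u'_2 u_1'^* \otimes u'_3 u_2'^* \otimes \cdots \otimes u'_{k+1}u_k'^* \otimes 1 \otimes 1 \otimes \cdots$$ exists in $\bigotimes_{i=1}^\infty M_n$.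
   Context: For an integer $n \geq 2$, the Cuntz algebra $\mathcal{O}_n$ is the universal unital $C^*$-algebra generated by isometries $S_1,\ldots,S_n$ with $\sum_{i=1}^n S_iS_i^*=1$. Endomorphisms of $\mathcal{O}_n$ are unital $*$-endomorphisms; for a unitary $v \in \mathcal{U}(\mathcal{O}_n)$, $\lambda_v$ denotes the endomorphism determined by $\lambda_v(S_i) = vS_i$, $i=1,\ldots,n$ (every endomorphism has this form for a unique $v$). For $k \geq 1$, $\mathcal{F}_n^k = \mathrm{span}\{S_{\alpha_1}\cdots S_{\alpha_k}S_{\beta_k}^*\cdots S_{\beta_1}^* : 1 \leq \alpha_j,\beta_j \leq n\} \simeq M_n^{\otimes k}$, and the core UHF-subalgebra $\mathcal{F}_n$ is the norm closure of $\bigcup_k \mathcal{F}_n^k$. It is canonically identified with the infinite $C^*$-tensor product $\bigotimes_{i=1}^\infty M_n$, where $x_1 \otimes \cdots \otimes x_k \otimes 1 \otimes 1 \otimes \cdots$ with $x_j \in M_n \simeq \mathcal{F}_n^1$ corresponds to $x_1\varphi(x_2)\cdots\varphi^{k-1}(x_k)$, and $\varphi(x) = \sum_{i=1}^n S_i x S_i^*$ is the canonical shift endomorphism. For a sequence $\underline{u}=(u_i)$ of unitaries in $\mathcal{F}_n^1$, $\alpha_{\underline{u}}$ is the automorphism of $\mathcal{F}_n$ with $$\alpha_{\underline{u}}(S_{\alpha_1}\cdots S_{\alpha_k}S_{\beta_k}^*\cdots S_{\beta_1}^* ) = u_1S_{\alpha_1}u_2S_{\alpha_2}\cdots u_kS_{\alpha_k}S_{\beta_k}^*u_k^*\cdots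 S_{\beta_2}^*u_2^*S_{\beta_1}^*u_1^*$$ for all $k \geq 1$ and all multi-indices of length $k$; in the tensor picture it is $\bigotimes_i \mathrm{Ad}(u_i)$. *)

theory Defs
  imports "HOL-Analysis.Analysis" "HOL-Algebra.Ring"
begin

section \<open>Unital C*-algebras as a type class\<close>

class cstar_algebra = real_normed_algebra_1 + banach +
  fixes scaleC :: "complex \<Rightarrow> 'a \<Rightarrow> 'a"  (infixr \<open>*\<^sub>C\<close> 75)
    and star :: "'a \<Rightarrow> 'a"
  assumes scaleC_add_right: "c *\<^sub>C (x + y) = c *\<^sub>C x + c *\<^sub>C y"
    and scaleC_add_left: "(c + d) *\<^sub>C x = c *\<^sub>C x + d *\<^sub>C x"
    and scaleC_scaleC: "c *\<^sub>C d *\<^sub>C x = (c * d) *\<^sub>C x"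
    and scaleR_scaleC: "scaleR r x = complex_of_real r *\<^sub>C x"
    and mult_scaleC_left: "(c *\<^sub>C x) * y = c *\<^sub>C (x * y)"
    and mult_scaleC_right: "x * (c *\<^sub>C y) = c *\<^sub>C (x * y)"
    and norm_scaleC: "norm (c *\<^sub>C x) = cmod c * norm x"
    and star_add: "star (x + y) = star x + star y"
    and star_scaleC: "star (c *\<^sub>C x) = cnj c *\<^sub>C star x"
    and star_mult: "star (x * y) = star y * star x"
    and star_star: "star (star x) = x"
    and cstar_identity: "norm (star x * x) = (norm x)\<^sup>2"

lemma scaleC_one: "1 *\<^sub>C x = (x :: 'a :: cstar_algebra)"
  using scaleR_scaleC[of 1 x] by simp

lemma vector_space_scaleC: "vector_space (scaleC :: complex \<Rightarrow> 'a \<Rightarrow> 'a :: cstar_algebra)"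
  by unfold_locales (simp_all add: scaleC_add_right scaleC_add_left scaleC_scaleC scaleC_one)

lemma star_one: "star 1 = (1 :: 'a :: cstar_algebra)"
  by (metis mult.left_neutral mult.right_neutral star_mult star_star)

abbreviation cspan :: "'a set \<Rightarrow> 'a :: cstar_algebra set"
  where "cspan \<equiv> module.span scaleC"

definition unitary :: "'a :: cstar_algebra \<Rightarrow> bool"
  where "unitary v \<longleftrightarrow> star v * v = 1 \<and> v * star v = 1"

definition unital_star_subalgebra :: "'a :: cstar_algebra set \<Rightarrow> bool"
  where "unital_star_subalgebra X \<longleftrightarrow>
    1 \<in> X \<and> (\<forall>x\<in>X. \<forall>y\<in>X. x + y \<in> X \<and> x * y \<in> X) \<and>
    (\<forall>c. \<forall>x\<in>X. c *\<^sub>C x \<in> X) \<and> (\<forall>x\<in>X. star x \<in> X)"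

definition unital_star_hom_on :: "'a :: cstar_algebra set \<Rightarrow> ('a \<Rightarrow> 'a) \<Rightarrow> bool"
  where "unital_star_hom_on X f \<longleftrightarrow>
    f 1 = 1 \<and>
    (\<forall>x\<in>X. \<forall>y\<in>X. f (x + y) = f x + f y \<and> f (x * y) = f x * f y) \<and>
    (\<forall>c. \<forall>x\<in>X. f (c *\<^sub>C x) = c *\<^sub>C f x) \<and>
    (\<forall>x\<in>X. f (star x) = star (f x))"

definition star_automorphism_on :: "'a :: cstar_algebra set \<Rightarrow> ('a \<Rightarrow> 'a) \<Rightarrow> bool"
  where "star_automorphism_on X f \<longleftrightarrow> unital_star_hom_on X f \<and> bij_betw f X X"

section \<open>Unital C*-algebras on carrier sets\<close>

text \<open>
  A universal property quantifies over all C*-algebras, hence over structures rather than over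
  types. Type class and locale describe the same objects (lemma \<open>unital_cstar_of_type\<close>), except
  that the locale also admits the zero algebra.
\<close>

record 'b cstar_struct = "'b ring" +
  cmul :: "complex \<Rightarrow> 'b \<Rightarrow> 'b"
  adj :: "'b \<Rightarrow> 'b"
  nrm :: "'b \<Rightarrow> real"

locale unital_cstar = ring B for B :: "'b cstar_struct" (structure) +
  assumes cmul_closed: "x \<in> carrier B \<Longrightarrow> cmul B c x \<in> carrier B"
    and cmul_add_right: "\<lbrakk>x \<in> carrier B; y \<in> carrier B\<rbrakk> \<Longrightarrow>
          cmul B c (x \<oplus> y) = cmul B c x \<oplus> cmul B c y"
    and cmul_add_left: "x \<in> carrier B \<Longrightarrow> cmul B (c + d) x = cmul B c x \<oplus> cmul B d x"
    and cmul_cmul: "x \<in> carrier B \<Longrightarrow> cmul B c (cmul B d x) = cmul B (c * d) x"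
    and cmul_one: "x \<in> carrier B \<Longrightarrow> cmul B 1 x = x"
    and mult_cmul_left: "\<lbrakk>x \<in> carrier B; y \<in> carrier B\<rbrakk> \<Longrightarrow> cmul B c x \<otimes> y = cmul B c (x \<otimes> y)"
    and mult_cmul_right: "\<lbrakk>x \<in> carrier B; y \<in> carrier B\<rbrakk> \<Longrightarrow> x \<otimes> cmul B c y = cmul B c (x \<otimes> y)"
    and adj_closed: "x \<in> carrier B \<Longrightarrow> adj B x \<in> carrier B"
    and adj_add: "\<lbrakk>x \<in> carrier B; y \<in> carrier B\<rbrakk> \<Longrightarrow> adj B (x \<oplus> y) = adj B x \<oplus> adj B y"
    and adj_cmul: "x \<in> carrier B \<Longrightarrow> adj B (cmul B c x) = cmul B (cnj c) (adj B x)"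
    and adj_mult: "\<lbrakk>x \<in> carrier B; y \<in> carrier B\<rbrakk> \<Longrightarrow> adj B (x \<otimes> y) = adj B y \<otimes> adj B x"
    and adj_adj: "x \<in> carrier B \<Longrightarrow> adj B (adj B x) = x"
    and nrm_nonneg: "x \<in> carrier B \<Longrightarrow> 0 \<le> nrm B x"
    and nrm_eq_0: "x \<in> carrier B \<Longrightarrow> nrm B x = 0 \<longleftrightarrow> x = \<zero>"
    and nrm_cmul: "x \<in> carrier B \<Longrightarrow> nrm B (cmul B c x) = cmod c * nrm B x"
    and nrm_triangle: "\<lbrakk>x \<in> carrier B; y \<in> carrier B\<rbrakk> \<Longrightarrow> nrm B (x \<oplus> y) \<le> nrm B x + nrm B y"
    and nrm_mult: "\<lbrakk>x \<in> carrier B; y \<in> carrier B\<rbrakk> \<Longrightarrow> nrm B (x \<otimes> y) \<le> nrm B x * nrm B y"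
    and nrm_cstar: "x \<in> carrier B \<Longrightarrow> nrm B (adj B x \<otimes> x) = (nrm B x)\<^sup>2"
    and nrm_complete: "Metric_space.mcomplete (carrier B) (\<lambda>x y. nrm B (x \<ominus> y))"

definition unital_star_hom_into :: "'b cstar_struct \<Rightarrow> ('a :: cstar_algebra \<Rightarrow> 'b) \<Rightarrow> bool"
  where "unital_star_hom_into B f \<longleftrightarrow>
    range f \<subseteq> carrier B \<and> f 1 = \<one>\<^bsub>B\<^esub> \<and>
    (\<forall>x y. f (x + y) = f x \<oplus>\<^bsub>B\<^esub> f y) \<and> (\<forall>x y. f (x * y) = f x \<otimes>\<^bsub>B\<^esub> f y) \<and>
    (\<forall>c x. f (c *\<^sub>C x) = cmul B c (f x)) \<and> (\<forall>x. f (star x) = adj B (f x))"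

definition cstar_of_type :: "'a :: cstar_algebra cstar_struct"
  where "cstar_of_type =
    \<lparr>carrier = UNIV, monoid.mult = (*), one = 1, ring.zero = 0, add = (+),
     cmul = scaleC, adj = star, nrm = norm\<rparr>"

lemma cstar_of_type_simps [simp]:
  "carrier (cstar_of_type :: 'a :: cstar_algebra cstar_struct) = UNIV"
  "x \<otimes>\<^bsub>cstar_of_type\<^esub> y = x * (y :: 'a)"
  "\<one>\<^bsub>cstar_of_type\<^esub> = (1 :: 'a)"
  "\<zero>\<^bsub>cstar_of_type\<^esub> = (0 :: 'a)"
  "x \<oplus>\<^bsub>cstar_of_type\<^esub> y = x + (y :: 'a)"
  "cmul cstar_of_type = (scaleC :: complex \<Rightarrow> 'a \<Rightarrow> 'a)"
  "adj cstar_of_type = (star :: 'a \<Rightarrow> 'a)"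
  "nrm cstar_of_type = (norm :: 'a \<Rightarrow> real)"
  by (simp_all add: cstar_of_type_def)

lemma ring_cstar_of_type: "ring (cstar_of_type :: 'a :: cstar_algebra cstar_struct)"
proof (rule ringI)
  show "abelian_group (cstar_of_type :: 'a cstar_struct)"
    by (rule abelian_groupI) (auto simp: algebra_simps intro: exI[of _ "- x" for x :: 'a])
  show "Group.monoid (cstar_of_type :: 'a cstar_struct)"
    by (rule monoidI) (auto simp: algebra_simps)
qed (auto simp: algebra_simps)

lemma a_minus_cstar_of_type [simp]:
  "x \<ominus>\<^bsub>cstar_of_type\<^esub> y = x - (y :: 'a :: cstar_algebra)"
proof -
  interpret R: ring "cstar_of_type :: 'a cstar_struct" by (rule ring_cstar_of_type)
  have "y \<oplus>\<^bsub>cstar_of_type\<^esub> (\<ominus>\<^bsub>cstar_of_type\<^esub> y) = \<zero>\<^bsub>cstar_of_type\<^esub>"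
    by (rule R.r_neg) simp
  then have "\<ominus>\<^bsub>cstar_of_type\<^esub> y = - y"
    by (simp add: eq_neg_iff_add_eq_0 add.commute)
  then show ?thesis by (simp add: a_minus_def)
qed

lemma unital_cstar_of_type: "unital_cstar (cstar_of_type :: 'a :: cstar_algebra cstar_struct)"
proof -
  have "Met_TC.mcomplete TYPE('a)"
    by (simp add: mcomplete_iff_complete complete_UNIV)
  then have "Metric_space.mcomplete UNIV (\<lambda>x y :: 'a. norm (x - y))"
    by (simp add: dist_norm[abs_def])
  then show ?thesis
    by (intro unital_cstar.intro ring_cstar_of_type unital_cstar_axioms.intro)
      (simp_all add: scaleC_add_right scaleC_add_left scaleC_scaleC scaleC_one
        mult_scaleC_left mult_scaleC_right norm_scaleC star_add star_scaleC star_mult star_star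
        cstar_identity norm_triangle_ineq norm_mult_ineq)
qed

lemma finsum_cstar_of_type [simp]:
  "finite I \<Longrightarrow> finsum cstar_of_type f I = (\<Sum>i\<in>I. f i :: 'a :: cstar_algebra)"
proof (induction I rule: finite_induct)
  interpret R: ring "cstar_of_type :: 'a cstar_struct" by (rule ring_cstar_of_type)
  { case empty show ?case by simp }
  { case (insert i I) then show ?case by (simp add: R.finsum_insert) }
qed

lemma unital_star_hom_into_cstar_of_type:
  "unital_star_hom_into cstar_of_type f \<longleftrightarrow> unital_star_hom_on UNIV f"
  by (auto simp: unital_star_hom_into_def unital_star_hom_on_def)

section \<open>The Cuntz algebra\<close>

definition cuntz_relations :: "nat \<Rightarrow> 'b cstar_struct \<Rightarrow> (nat \<Rightarrow> 'b) \<Rightarrow> bool"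
  where "cuntz_relations n B T \<longleftrightarrow>
    (\<forall>i\<in>{1..n}. T i \<in> carrier B \<and> adj B (T i) \<otimes>\<^bsub>B\<^esub> T i = \<one>\<^bsub>B\<^esub>) \<and>
    (\<Oplus>\<^bsub>B\<^esub>i\<in>{1..n}. T i \<otimes>\<^bsub>B\<^esub> adj B (T i)) = \<one>\<^bsub>B\<^esub>"

text \<open>
  \<open>cuntz_algebra n S\<close>: the type \<open>'a\<close>, with the elements \<open>S 1, \<dots>, S n\<close>, is the universal unital
  C*-algebra generated by isometries satisfying the Cuntz relation. The test algebras \<open>B\<close> have
  carriers inside \<open>'a\<close>; this is no restriction. Only the C*-subalgebra generated by
  \<open>T 1, \<dots>, T n\<close> matters, it is separable, so it has at most continuum many elements, and
  the nonzero complex vector space \<open>'a\<close> has at least as many.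
\<close>

definition cuntz_algebra :: "nat \<Rightarrow> (nat \<Rightarrow> 'a :: cstar_algebra) \<Rightarrow> bool"
  where "cuntz_algebra n S \<longleftrightarrow>
    cuntz_relations n cstar_of_type S \<and>
    (\<forall>X. unital_star_subalgebra X \<and> closed X \<and> S ` {1..n} \<subseteq> X \<longrightarrow> X = UNIV) \<and>
    (\<forall>(B :: 'a cstar_struct) T. unital_cstar B \<and> cuntz_relations n B T \<longrightarrow>
       (\<exists>!f. unital_star_hom_into B f \<and> (\<forall>i\<in>{1..n}. f (S i) = T i)))"

definition cuntz_endo :: "nat \<Rightarrow> (nat \<Rightarrow> 'a :: cstar_algebra) \<Rightarrow> 'a \<Rightarrow> 'a \<Rightarrow> 'a"
  where "cuntz_endo n S v =
    (THE f. unital_star_hom_on UNIV f \<and> (\<forall>i\<in>{1..n}. f (S i) = v * S i))"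

lemma cuntz_endo_ex1:
  assumes "cuntz_algebra n S" "unitary v"
  shows "\<exists>!f. unital_star_hom_on UNIV f \<and> (\<forall>i\<in>{1..n}. f (S i) = v * S i)"
proof -
  have rel: "star (S i) * S i = 1" if "i \<in> {1..n}" for i
    using assms(1) that by (simp add: cuntz_algebra_def cuntz_relations_def)
  have sum1: "(\<Sum>i\<in>{1..n}. S i * star (S i)) = 1"
    using assms(1) by (simp add: cuntz_algebra_def cuntz_relations_def)
  have "star (v * S i) * (v * S i) = 1" if "i \<in> {1..n}" for i
  proof -
    have "star (v * S i) * (v * S i) = star (S i) * (star v * v) * S i"
      by (simp add: star_mult mult.assoc)
    then show ?thesis
      using rel[OF that] assms(2) by (simp add: unitary_def)
  qed
  moreover have "(\<Sum>i\<in>{1..n}. v * S i * star (v * S i)) = 1"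
  proof -
    have "(\<Sum>i\<in>{1..n}. v * S i * star (v * S i)) = v * (\<Sum>i\<in>{1..n}. S i * star (S i)) * star v"
      by (simp add: star_mult mult.assoc sum_distrib_left sum_distrib_right)
    then show ?thesis
      using sum1 assms(2) by (simp add: unitary_def)
  qed
  ultimately have "cuntz_relations n cstar_of_type (\<lambda>i. v * S i)"
    by (simp add: cuntz_relations_def)
  then have "\<exists>!f. unital_star_hom_into cstar_of_type f \<and> (\<forall>i\<in>{1..n}. f (S i) = v * S i)"
    using assms(1)[unfolded cuntz_algebra_def, THEN conjunct2, THEN conjunct2, rule_format,
        OF conjI, OF unital_cstar_of_type] by simp
  then show ?thesis
    unfolding unital_star_hom_into_cstar_of_type .
qed

definition fin_core :: "nat \<Rightarrow> (nat \<Rightarrow> 'a :: cstar_algebra) \<Rightarrow> nat \<Rightarrow> 'a set"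
  where "fin_core n S k = cspan
    {prod_list (map S a) * star (prod_list (map S b)) | a b.
       length a = k \<and> length b = k \<and> set a \<subseteq> {1..n} \<and> set b \<subseteq> {1..n}}"

definition uhf_core :: "nat \<Rightarrow> (nat \<Rightarrow> 'a :: cstar_algebra) \<Rightarrow> 'a set"
  where "uhf_core n S = closure (\<Union>k\<in>{1..}. fin_core n S k)"

definition canonical_shift :: "nat \<Rightarrow> (nat \<Rightarrow> 'a :: cstar_algebra) \<Rightarrow> 'a \<Rightarrow> 'a"
  where "canonical_shift n S x = (\<Sum>i=1..n. S i * x * star (S i))"

text \<open>
  \<open>elem_tensor n S x k\<close> is \<open>x 1 \<otimes> \<dots> \<otimes> x k \<otimes> 1 \<otimes> 1 \<otimes> \<dots>\<close>,
  i.e. \<open>x 1 * \<phi> (x 2) * \<dots> * \<phi>\<^sup>k\<^sup>-\<^sup>1 (x k)\<close> with \<open>\<phi>\<close> the canonical shift.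
\<close>

definition elem_tensor :: "nat \<Rightarrow> (nat \<Rightarrow> 'a :: cstar_algebra) \<Rightarrow> (nat \<Rightarrow> 'a) \<Rightarrow> nat \<Rightarrow> 'a"
  where "elem_tensor n S x k =
    prod_list (map (\<lambda>j. (canonical_shift n S ^^ (j - 1)) (x j)) [1..<k + 1])"

text \<open>\<open>u 1 \<otimes> u 2 (u 1)* \<otimes> \<dots> \<otimes> u (k+1) (u k)* \<otimes> 1 \<otimes> \<dots>\<close>\<close>

definition cocycle_tensor :: "nat \<Rightarrow> (nat \<Rightarrow> 'a :: cstar_algebra) \<Rightarrow> (nat \<Rightarrow> 'a) \<Rightarrow> nat \<Rightarrow> 'a"
  where "cocycle_tensor n S u k =
    elem_tensor n S (\<lambda>j. if j = 1 then u 1 else u j * star (u (j - 1))) (k + 1)"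

text \<open>\<open>u 1 * S a\<^sub>1 * u 2 * S a\<^sub>2 * \<dots> * u k * S a\<^sub>k\<close>; lists are indexed from 0\<close>

definition twisted_word :: "(nat \<Rightarrow> 'a :: cstar_algebra) \<Rightarrow> (nat \<Rightarrow> 'a) \<Rightarrow> nat list \<Rightarrow> 'a"
  where "twisted_word S u a = prod_list (map (\<lambda>j. u (j + 1) * S (a ! j)) [0..<length a])"

text \<open>
  The automorphism is only defined on the core; extensionality fixes an irrelevant value outside
  and makes the description definite.
\<close>

definition product_automorphism ::
    "nat \<Rightarrow> (nat \<Rightarrow> 'a :: cstar_algebra) \<Rightarrow> (nat \<Rightarrow> 'a) \<Rightarrow> 'a \<Rightarrow> 'a"
  where "product_automorphism n S u = (THE f.
    f \<in> extensional (uhf_core n S) \<and> star_automorphism_on (uhf_core n S) f \<and>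
    (\<forall>k\<ge>1. \<forall>a b. length a = k \<and> length b = k \<and> set a \<subseteq> {1..n} \<and> set b \<subseteq> {1..n} \<longrightarrow>
       f (prod_list (map S a) * star (prod_list (map S b))) =
         twisted_word S u a * star (twisted_word S u b)))"

end

theory Submission
  imports Defs
begin

text \<open>
  Write \<open>\<phi>\<close> for the canonical shift, \<open>F k\<close> for the finite-dimensional cores, and
  \<open>U k = u 1 \<phi>(u 2) \<dots> \<phi>\<^sup>k\<^sup>-\<^sup>1(u k)\<close>. Since \<open>\<phi>\<^sup>k(x)\<close> commutes with \<open>F k\<close>, the product automorphism
  is \<open>\<alpha> x = lim U k x (U k)*\<close>, the cocycle is \<open>v k = U (k+1) \<phi>(U k)*\<close>, and
  \<open>v k S i = U (k+1) S i (U k)*\<close>. If \<open>v k \<rightarrow> v\<close>, multiplying such terms gives \<open>\<lambda>\<^sub>v = \<alpha>\<close> on the core, and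
  the inverse of \<open>\<lambda>\<^sub>v\<close> is \<open>\<lambda>\<^sub>w\<close> with \<open>w = \<alpha>\<^sup>-\<^sup>1(v*)\<close>, the limit of the cocycle of the adjoint sequence.

  Conversely let \<open>\<rho>\<close> extend \<open>\<alpha>\<close> and let \<open>w\<close> be the unitary with \<open>\<rho>(S i) = w S i\<close>. Then \<open>w\<close> and \<open>v k\<close>
  implement the same map on \<open>F (k+1)\<close>, so \<open>(v k)* w\<close> lies in the commutant of \<open>F (k+1)\<close>. The iterates of
  \<open>\<psi> x = (1/n) \<Sum>i. S i* x S i\<close> converge in norm to a KMS state \<open>\<omega>\<close>, and \<open>h = \<phi>\<^sup>k \<psi>\<^sup>k h\<close> for \<open>h\<close> in
  the commutant of \<open>F k\<close>; hence the commutant of the core is trivial. Applied to \<open>w* \<gamma>(w)\<close> for gauge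
  automorphisms \<open>\<gamma>\<close>, this shows that \<open>w\<close> is homogeneous, the KMS condition forces degree zero, and
  so \<open>w\<close> lies in the core. Approximating \<open>w\<close> in some \<open>F m\<close> shows that \<open>(v k)* w\<close> is asymptotically scalar,
  and the phases of these scalars are the required \<open>\<theta>\<close>.
\<close>

section \<open>Adjoints, unitaries and limits in a C*-algebra\<close>

global_interpretation cvec: vector_space "scaleC :: complex \<Rightarrow> 'a \<Rightarrow> 'a :: cstar_algebra"
  by (rule vector_space_scaleC)

lemma star_zero [simp]: "star 0 = (0 :: 'a :: cstar_algebra)"
  using star_add[of 0 "0 :: 'a"] by simp

lemma star_minus: "star (- x) = - star (x :: 'a :: cstar_algebra)"
  using star_add[of x "- x"] by (simp add: eq_neg_iff_add_eq_0 add.commute)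

lemma star_diff: "star (x - y) = star x - star (y :: 'a :: cstar_algebra)"
  using star_add[of x "- y"] by (simp add: star_minus)

lemma star_sum: "star (\<Sum>i\<in>I. f i) = (\<Sum>i\<in>I. star (f i :: 'a :: cstar_algebra))"
  by (induction I rule: infinite_finite_induct) (auto simp: star_add)

lemma star_power: "star (x ^ k) = star (x :: 'a :: cstar_algebra) ^ k"
  by (induction k) (auto simp: star_one star_mult power_commutes)

text \<open>The C*-identity and submultiplicativity bound \<open>(norm y)\<^sup>2\<close> by
  \<open>norm (star y) * norm y\<close>. Cancelling \<open>norm y\<close> gives one inequality, and
  applying it to \<open>star x\<close> as well gives the other.\<close>

lemma norm_star [simp]: "norm (star x) = norm (x :: 'a :: cstar_algebra)"
proof -
  have le: "norm y \<le> norm (star y)" for y :: 'a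
  proof (cases "y = 0")
    case False
    have "(norm y)\<^sup>2 \<le> norm (star y) * norm y"
      using norm_mult_ineq[of "star y" y] by (simp add: cstar_identity)
    with False show ?thesis by (simp add: power2_eq_square)
  qed simp
  show ?thesis using le[of x] le[of "star x"] by (simp add: star_star)
qed

lemma bounded_linear_star: "bounded_linear (star :: 'a \<Rightarrow> 'a :: cstar_algebra)"
  by (rule bounded_linear_intro[where K = 1])
    (auto simp: star_add scaleR_scaleC star_scaleC)

lemmas tendsto_star = bounded_linear.tendsto[OF bounded_linear_star]

lemma bounded_linear_scaleC: "bounded_linear (\<lambda>x :: 'a :: cstar_algebra. c *\<^sub>C x)"
  by (rule bounded_linear_intro[where K = "cmod c"])
    (auto simp: scaleC_add_right scaleR_scaleC scaleC_scaleC norm_scaleC mult.commute)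

lemmas tendsto_scaleC = bounded_linear.tendsto[OF bounded_linear_scaleC]

lemma norm_isometry:
  assumes "star w * w = (1 :: 'a :: cstar_algebra)" shows "norm w = 1"
proof -
  have "(norm w)\<^sup>2 = 1" using cstar_identity[of w] assms by simp
  then show ?thesis using norm_ge_zero[of w] by (simp add: power2_eq_1_iff)
qed

lemma norm_unitary: "unitary w \<Longrightarrow> norm w = 1"
  by (simp add: unitary_def norm_isometry)

lemma norm_projection_le_1:
  assumes "star q = q" "q * q = (q :: 'a :: cstar_algebra)" shows "norm q \<le> 1"
proof -
  have "norm q * norm q = norm q" using cstar_identity[of q] assms by (simp add: power2_eq_square)
  then show ?thesis by (cases "q = 0") auto
qed

lemma unitary_one [simp]: "unitary 1"
  by (simp add: unitary_def star_one)

lemma unitary_star: "unitary v \<Longrightarrow> unitary (star v)" by (simp add: unitary_def star_star)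

lemma unitary_mult: "unitary v \<Longrightarrow> unitary w \<Longrightarrow> unitary (v * w)"
  unfolding unitary_def star_mult by (metis mult.assoc mult.right_neutral)

lemma unitary_limit:
  assumes "\<And>k. unitary (f k)" "f \<longlonglongrightarrow> v" shows "unitary v"
proof -
  have "(\<lambda>k. star (f k) * f k) \<longlonglongrightarrow> star v * v" "(\<lambda>k. f k * star (f k)) \<longlonglongrightarrow> v * star v"
    by (intro tendsto_mult tendsto_star assms)+
  moreover have "star (f k) * f k = 1" "f k * star (f k) = 1" for k
    using assms(1) by (auto simp: unitary_def)
  ultimately show ?thesis by (auto simp: unitary_def LIMSEQ_const_iff)
qed

lemma norm_unitary_mult_left:
  assumes "unitary w" shows "norm (w * x) = norm x"
proof -
  have "norm (w * x) \<le> norm x"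
    using norm_mult_ineq[of w x] norm_unitary[OF assms] by simp
  moreover have "norm (star w * (w * x)) \<le> norm (w * x)"
    using norm_mult_ineq[of "star w" "w * x"] norm_unitary[OF assms] by simp
  ultimately show ?thesis using assms by (simp add: unitary_def mult.assoc[symmetric])
qed

lemma norm_unitary_mult_right:
  assumes "unitary w" shows "norm (x * w) = norm x"
  using norm_unitary_mult_left[OF unitary_star[OF assms], of "star x"]
  by (metis norm_star star_mult)

lemma unital_star_subalgebra_closure:
  fixes X :: "'a :: cstar_algebra set"
  assumes "unital_star_subalgebra X" shows "unital_star_subalgebra (closure X)"
proof -
  have X: "1 \<in> X" "\<And>x y. x \<in> X \<Longrightarrow> y \<in> X \<Longrightarrow> x + y \<in> X"
    "\<And>x y. x \<in> X \<Longrightarrow> y \<in> X \<Longrightarrow> x * y \<in> X"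
    "\<And>c x. x \<in> X \<Longrightarrow> c *\<^sub>C x \<in> X" "\<And>x. x \<in> X \<Longrightarrow> star x \<in> X"
    using assms by (auto simp: unital_star_subalgebra_def)
  show ?thesis
    unfolding unital_star_subalgebra_def
  proof (intro conjI ballI allI)
    show "1 \<in> closure X" using X(1) closure_subset by blast
    fix x assume "x \<in> closure X"
    then obtain f where f: "\<And>k. f k \<in> X" "f \<longlonglongrightarrow> x" by (auto simp: closure_sequential)
    show "c *\<^sub>C x \<in> closure X" for c
      unfolding closure_sequential using X(4)[OF f(1)] tendsto_scaleC[OF f(2)]
      by (intro exI[of _ "\<lambda>k. c *\<^sub>C f k"]) auto
    show "star x \<in> closure X"
      unfolding closure_sequential using X(5)[OF f(1)] tendsto_star[OF f(2)]
      by (intro exI[of _ "\<lambda>k. star (f k)"]) auto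
    fix y assume "y \<in> closure X"
    then obtain g where g: "\<And>k. g k \<in> X" "g \<longlonglongrightarrow> y" by (auto simp: closure_sequential)
    show "x + y \<in> closure X"
      unfolding closure_sequential using X(2)[OF f(1) g(1)] tendsto_add[OF f(2) g(2)]
      by (intro exI[of _ "\<lambda>k. f k + g k"]) auto
    show "x * y \<in> closure X"
      unfolding closure_sequential using X(3)[OF f(1) g(1)] tendsto_mult[OF f(2) g(2)]
      by (intro exI[of _ "\<lambda>k. f k * g k"]) auto
  qed
qed

lemma norm_unitary_conjugate: "unitary w \<Longrightarrow> norm (w * x * star w) = norm x"
  by (simp add: norm_unitary_mult_left norm_unitary_mult_right unitary_star)

text \<open>Conjugation by a unitary is isometric, so the two sequences differ in norm by
  \<open>norm (y m - x)\<close>. The unitaries \<open>W m\<close> themselves need not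
  converge.\<close>

lemma conjugate_limit:
  fixes y :: "nat \<Rightarrow> 'a :: cstar_algebra"
  assumes W: "\<And>m. unitary (W m)" and y: "y \<longlonglongrightarrow> x" and lim: "(\<lambda>m. W m * x * star (W m)) \<longlonglongrightarrow> l"
  shows "(\<lambda>m. W m * y m * star (W m)) \<longlonglongrightarrow> l"
proof -
  have "(\<lambda>m. norm (y m - x)) \<longlonglongrightarrow> 0"
    using y by (simp add: LIM_zero tendsto_norm_zero)
  moreover have "norm (W m * y m * star (W m) - W m * x * star (W m)) = norm (y m - x)" for m
    using norm_unitary_conjugate[OF W, of m "y m - x"] by (simp add: algebra_simps)
  ultimately have "(\<lambda>m. norm (W m * y m * star (W m) - W m * x * star (W m))) \<longlonglongrightarrow> 0"
    by simp
  then show ?thesis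
    using tendsto_add[OF tendsto_norm_zero_cancel lim] by fastforce
qed

section \<open>Contractivity of *-homomorphisms\<close>

text \<open>Squaring the binomial series of (1 - t)^(1/2) must give 1 - t. Vandermonde's identity
  collapses the convolution to binomial coefficients of exponent 1.\<close>

lemma gbinomial_half_Cauchy_product:
  "(\<Sum>i\<le>k. ((1/2 gchoose i) * (- 1) ^ i) * ((1/2 gchoose (k - i)) * (- 1) ^ (k - i)))
     = (if k = 0 then 1 else if k = 1 then - 1 else 0 :: real)"
proof -
  have "(\<Sum>i\<le>k. ((1/2 gchoose i) * (- 1) ^ i) * ((1/2 gchoose (k - i)) * (- 1) ^ (k - i)))
     = (\<Sum>i\<le>k. (- 1) ^ k * ((1/2 gchoose i) * (1/2 gchoose (k - i)) :: real))"
  proof (rule sum.cong)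
    fix i assume "i \<in> {..k}"
    then have "(- 1) ^ i * (- 1) ^ (k - i) = ((- 1) ^ k :: real)"
      by (simp flip: power_add)
    then show "((1/2 gchoose i) * (- 1) ^ i) * ((1/2 gchoose (k - i)) * (- 1) ^ (k - i))
      = (- 1) ^ k * ((1/2 gchoose i) * (1/2 gchoose (k - i)) :: real)"
      by (simp add: mult_ac)
  qed simp
  also have "\<dots> = (- 1) ^ k * (\<Sum>i\<le>k. (1/2 gchoose i) * (1/2 gchoose (k - i)))"
    by (simp add: sum_distrib_left)
  also have "(\<Sum>i\<le>k. (1/2 gchoose i) * (1/2 gchoose (k - i))) = ((1/2 + 1/2) gchoose k :: real)"
    using gbinomial_Vandermonde[of "1/2" "1/2" k] by (simp add: atMost_atLeast0)
  also have "((1/2 + 1/2) gchoose k :: real) = of_nat (1 choose k)"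
    by (simp add: binomial_gbinomial)
  finally show ?thesis by (cases k rule: nat.exhaust) (auto simp: binomial_eq_0)
qed

text \<open>The binomial series for the square root of 1 - q converges absolutely. Its partial sums
  are real polynomials in \<open>q\<close>, so the limit stays in \<open>X\<close>, is self-adjoint,
  and commutes with everything that commutes with \<open>q\<close>.\<close>

lemma sqrt_one_minus_exists:
  fixes q :: "'a :: cstar_algebra"
  assumes X: "unital_star_subalgebra X" "closed X" and q: "q \<in> X" "star q = q" "norm q < 1"
  obtains y where "y \<in> X" "star y = y" "y * y = 1 - q" "\<And>z. z * q = q * z \<Longrightarrow> z * y = y * z"
proof -
  define a where "a k = ((1/2 gchoose k) * (- 1) ^ k :: real)" for k
  define t where "t k = a k *\<^sub>R q ^ k" for k
  \<comment> \<open>The point \<open>(1 + norm q) / 2\<close> lies strictly between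
    \<open>norm q\<close> and 1; convergence there yields absolute convergence at
    \<open>norm q\<close>.\<close>
  have "summable (\<lambda>k. norm ((1/2 gchoose k :: real) * norm q ^ k))"
    using gen_binomial_real[of "(1 + norm q) / 2" "1/2"] q(3)
    by (intro powser_insidea[of _ "(1 + norm q) / 2"]) (auto intro: sums_summable)
  then have "summable (\<lambda>k. \<bar>a k\<bar> * norm q ^ k)"
    by (simp add: a_def abs_mult power_abs)
  moreover have "norm (t k) \<le> \<bar>a k\<bar> * norm q ^ k" for k
    by (simp add: t_def mult_left_mono norm_power_ineq)
  ultimately have sn: "summable (\<lambda>k. norm (t k))"
    by (intro summable_comparison_test[of "\<lambda>k. norm (t k)" "\<lambda>k. \<bar>a k\<bar> * norm q ^ k"]) auto
  then have st: "summable t" by (rule summable_norm_cancel)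
  define y where "y = (\<Sum>k. t k)"
  have lim: "(\<lambda>N. \<Sum>k<N. t k) \<longlonglongrightarrow> y"
    unfolding y_def by (rule summable_LIMSEQ[OF st])
  have qk: "q ^ k \<in> X" for k
    using X(1) q(1) by (induction k) (auto simp: unital_star_subalgebra_def)
  have tX: "t k \<in> X" for k
    using X(1) qk by (auto simp: t_def scaleR_scaleC unital_star_subalgebra_def)
  have X0: "0 \<in> X"
    using X(1) unfolding unital_star_subalgebra_def by (metis cvec.scale_zero_left)
  have "(\<Sum>k<N. t k) \<in> X" for N
    by (induction N) (use X(1) tX X0 in \<open>auto simp: unital_star_subalgebra_def\<close>)
  then have "y \<in> X" using closed_sequentially[OF X(2) _ lim] by blast
  moreover have "star y = y"
  proof -
    have "star (t k) = t k" for k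
      by (simp add: t_def scaleR_scaleC star_scaleC star_power q(2))
    then show ?thesis
      unfolding y_def using bounded_linear.suminf[OF bounded_linear_star st] by simp
  qed
  moreover have "y * y = 1 - q"
  proof -
    have "(\<Sum>i\<le>k. t i * t (k - i)) = (if k = 0 then 1 else if k = 1 then - 1 else 0) *\<^sub>R q ^ k" for k
    proof -
      have "(\<Sum>i\<le>k. t i * t (k - i)) = (\<Sum>i\<le>k. a i * a (k - i)) *\<^sub>R q ^ k"
        by (simp add: t_def scaleR_sum_left mult.commute flip: power_add)
      then show ?thesis unfolding a_def gbinomial_half_Cauchy_product .
    qed
    then have "y * y = (\<Sum>k. (if k = 0 then 1 else if k = 1 then - 1 else 0) *\<^sub>R q ^ k)"
      unfolding y_def using Cauchy_product[OF sn sn] by simp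
    also have "\<dots> = (\<Sum>k\<in>{0,1}. (if k = 0 then 1 else if k = 1 then - 1 else 0) *\<^sub>R q ^ k)"
      by (rule suminf_finite) auto
    finally show ?thesis by simp
  qed
  moreover have "z * y = y * z" if "z * q = q * z" for z
  proof -
    have "z * q ^ k = q ^ k * z" for k
      using that by (metis power_commuting_commutes)
    then have "z * t k = t k * z" for k by (simp add: t_def)
    then show ?thesis
      unfolding y_def by (simp add: suminf_mult[OF st, symmetric] suminf_mult2[OF st])
  qed
  ultimately show ?thesis using that by blast
qed

text \<open>With \<open>y\<^sup>2 = 1 - h\<^sup>2\<close> the element \<open>f h + \<i> f y\<close> is unitary and \<open>f h\<close> is its real part.\<close>

lemma star_hom_contractive:
  fixes f :: "'a :: cstar_algebra \<Rightarrow> 'a"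
  assumes X: "unital_star_subalgebra X" "closed X" and f: "unital_star_hom_on X f" and x: "x \<in> X"
  shows "norm (f x) \<le> norm x"
proof -
  have f_mult: "f (x * y) = f x * f y" and f_add: "f (x + y) = f x + f y"
    and f_star: "f (star x) = star (f x)" and f_scale: "f (c *\<^sub>C x) = c *\<^sub>C f x"
    if "x \<in> X" "y \<in> X" for x y c
    using f that by (auto simp: unital_star_hom_on_def)
  have f1: "f 1 = 1" using f by (simp add: unital_star_hom_on_def)
  have X_mult: "x * y \<in> X" and X_star: "star x \<in> X" and X_scale: "c *\<^sub>C x \<in> X"
    if "x \<in> X" "y \<in> X" for x y c
    using X(1) that by (auto simp: unital_star_subalgebra_def)
  have small: "norm (f h) \<le> 1" if h: "h \<in> X" "star h = h" "norm h < 1" for h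
  proof -
    have hh: "norm (h * h) < 1" "star (h * h) = h * h"
      using cstar_identity[of h] h(2,3) by (simp_all add: abs_square_less_1 star_mult)
    obtain y where y: "y \<in> X" "star y = y" "y * y = 1 - h * h"
        "\<And>z. z * (h * h) = h * h * z \<Longrightarrow> z * y = y * z"
      using sqrt_one_minus_exists[OF X X_mult[OF h(1) h(1)] hh(2) hh(1)] by blast
    have comm: "f h * f y = f y * f h"
      using y(4)[of h] f_mult[OF h(1) y(1)] f_mult[OF y(1) h(1)] by (simp add: mult.assoc)
    have sq: "f h * f h + f y * f y = 1"
      using f_mult[OF h(1) h(1)] f_mult[OF y(1) y(1)] f_add[OF X_mult[OF h(1) h(1)] X_mult[OF y(1) y(1)]]
      by (simp add: y(3) f1)
    have sa: "star (f h) = f h" "star (f y) = f y"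
      using f_star[OF h(1) h(1)] f_star[OF y(1) y(1)] h(2) y(2) by auto
    define w where "w = f h + \<i> *\<^sub>C f y"
    have sw: "star w = f h - \<i> *\<^sub>C f y"
      by (simp add: w_def star_add star_scaleC sa cvec.scale_minus_left)
    have "star w * w = f h * f h + f y * f y"
      unfolding sw unfolding w_def
      by (simp add: algebra_simps mult_scaleC_left mult_scaleC_right scaleC_scaleC comm)
    then have "star w * w = 1" by (simp add: sq)
    then have "norm w = 1" by (rule norm_isometry)
    then have "norm (w + star w) \<le> 2"
      using norm_triangle_ineq[of w "star w"] by simp
    moreover have "w + star w = 2 *\<^sub>R f h"
      unfolding sw by (simp add: w_def scaleR_2)
    ultimately show ?thesis by simp
  qed
  \<comment> \<open>\<open>small\<close> is applied to \<open>h\<close> divided by an arbitrary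
    \<open>t\<close> above \<open>norm h\<close>; letting \<open>t\<close> decrease gives the
    bound.\<close>
  have sa: "norm (f h) \<le> norm h" if h: "h \<in> X" "star h = h" for h
  proof (rule dense_ge)
    fix t assume t: "norm h < t"
    then have t0: "t > 0" using norm_ge_zero[of h] by linarith
    have "norm (f (complex_of_real (inverse t) *\<^sub>C h)) \<le> 1"
      using t t0 h by (intro small) (auto simp: X_scale star_scaleC norm_scaleC norm_divide field_simps)
    then show "norm (f h) \<le> t"
      using t0 h(1) by (simp add: f_scale[OF h(1) h(1)] norm_scaleC norm_divide field_simps)
  qed
  have "norm (f (star x * x)) \<le> norm (star x * x)"
    using x by (intro sa) (auto simp: X_mult X_star star_mult star_star)
  then have "(norm (f x))\<^sup>2 \<le> (norm x)\<^sup>2"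
    using x by (simp add: f_mult X_star f_star cstar_identity)
  then show ?thesis by simp
qed

section \<open>The unit as an extreme point of the unit ball\<close>

lemma root_of_unity_eq_iff:
  assumes "N > 0"
  shows "cis (2 * pi / real N) ^ j = cis (2 * pi / real N) ^ k \<longleftrightarrow> j mod N = k mod N"
proof -
  have "cis (2 * pi / real N) ^ m = exp (2 * of_real pi * \<i> * of_nat m / of_nat N)" for m
    unfolding Complex.DeMoivre by (simp add: cis_conv_exp mult_ac)
  then show ?thesis
    using complex_root_unity_eq[of N j k] assms by simp
qed

lemma sum_powers_root_of_unity:
  assumes "N > 0"
  shows "(\<Sum>j<N. (cis (2 * pi / real N) ^ m) ^ j) = (if N dvd m then of_nat N else 0)"
proof -
  have root: "cis (2 * pi / real N) ^ m = 1 \<longleftrightarrow> N dvd m"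
    using root_of_unity_eq_iff[OF assms, of m 0] by (simp add: mod_eq_0_iff_dvd)
  have "(cis (2 * pi / real N) ^ m) ^ N = cis (2 * pi / real N) ^ (m * N)"
    by (simp add: power_mult)
  also have "\<dots> = 1"
    using root_of_unity_eq_iff[OF assms, of "m * N" 0] by simp
  finally show ?thesis
    using root by (auto simp: geometric_sum)
qed

text \<open>
  The hypothesis bounds \<open>1 + z c\<close> by one on a disc, hence also \<open>(1 + z c)\<^sup>k\<close>, whose linear
  coefficient \<open>k c\<close> is recovered by averaging over roots of unity.
\<close>

lemma selfadjoint_eq_0:
  fixes c :: "'a :: cstar_algebra"
  assumes sa: "star c = c" and le: "norm (1 + c) \<le> 1" "norm (1 - c) \<le> 1"
  shows "c = 0"
proof -
  \<comment> \<open>The mean of the squares of \<open>1 + c\<close> and \<open>1 - c\<close> is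
    \<open>1 + c * c\<close>. As \<open>c\<close> is self-adjoint, this is also
    \<open>star y * y\<close> for \<open>y = 1 + \<i> *\<^sub>C c\<close> and for
    \<open>y = 1 - \<i> *\<^sub>C c\<close>, so the hypothesis passes from c to its imaginary
    multiple.\<close>
  have "norm (1 + c * c) \<le> 1"
  proof -
    have "2 *\<^sub>R (1 + c * c) = (1 + c) * (1 + c) + (1 - c) * (1 - c)"
      by (simp add: algebra_simps scaleR_2)
    moreover have "norm ((1 + c) * (1 + c)) \<le> 1" "norm ((1 - c) * (1 - c)) \<le> 1"
      using norm_mult_ineq[of "1 + c" "1 + c"] norm_mult_ineq[of "1 - c" "1 - c"] le
        mult_mono[OF le(1) le(1)] mult_mono[OF le(2) le(2)] by auto
    ultimately have "norm (2 *\<^sub>R (1 + c * c)) \<le> 2"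
      using norm_triangle_ineq[of "(1 + c) * (1 + c)" "(1 - c) * (1 - c)"] by simp
    then show ?thesis by simp
  qed
  moreover have "star (1 + \<i> *\<^sub>C c) * (1 + \<i> *\<^sub>C c) = 1 + c * c"
    "star (1 - \<i> *\<^sub>C c) * (1 - \<i> *\<^sub>C c) = 1 + c * c"
    by (simp_all add: star_add star_diff star_one star_scaleC sa algebra_simps mult_scaleC_left
        mult_scaleC_right scaleC_scaleC cvec.scale_minus_left scaleC_one)
  ultimately have "(norm (1 + \<i> *\<^sub>C c))\<^sup>2 \<le> 1" "(norm (1 - \<i> *\<^sub>C c))\<^sup>2 \<le> 1"
    by (simp_all flip: cstar_identity)
  then have le': "norm (1 + \<i> *\<^sub>C c) \<le> 1" "norm (1 - \<i> *\<^sub>C c) \<le> 1"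
    by (simp_all add: abs_square_le_1)
  have real_dir: "norm (1 + complex_of_real s *\<^sub>C b) \<le> 1"
    if "norm (1 + b) \<le> 1" "norm (1 - b) \<le> 1" "\<bar>s\<bar> \<le> 1" for s and b :: 'a
  proof -
    have "2 *\<^sub>R (1 + complex_of_real s *\<^sub>C b) = (1 + s) *\<^sub>R (1 + b) + (1 - s) *\<^sub>R (1 - b)"
    proof -
      have "(1 + s) *\<^sub>R (1 + b) + (1 - s) *\<^sub>R (1 - b) = (1 + s *\<^sub>R b) + (1 + s *\<^sub>R b)"
        by (simp add: scaleR_add_right scaleR_diff_right scaleR_add_left scaleR_diff_left)
      moreover have "complex_of_real s *\<^sub>C b = s *\<^sub>R b" by (rule scaleR_scaleC[symmetric])
      ultimately show ?thesis by (simp only: scaleR_2)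
    qed
    also have "norm \<dots> \<le> (1 + s) * norm (1 + b) + (1 - s) * norm (1 - b)"
      using that(3) by (intro norm_triangle_le) (auto simp: abs_le_iff)
    also have "\<dots> \<le> (1 + s) * 1 + (1 - s) * 1"
      using that by (intro add_mono mult_left_mono) auto
    finally show ?thesis by simp
  qed
  \<comment> \<open>The element is the midpoint of one point in the real and one in the imaginary
    direction, with parameters \<open>2 * Re z\<close> and \<open>2 * Im z\<close>. Radius one half
    keeps both parameters within [-1, 1].\<close>
  have disc: "norm (1 + z *\<^sub>C c) \<le> 1" if "cmod z \<le> 1/2" for z
  proof -
    have "\<bar>2 * Re z\<bar> \<le> 1" "\<bar>2 * Im z\<bar> \<le> 1"
      using that abs_Re_le_cmod[of z] abs_Im_le_cmod[of z] by auto
    then have b: "norm (1 + complex_of_real (2 * Re z) *\<^sub>C c) \<le> 1"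
      "norm (1 + complex_of_real (2 * Im z) *\<^sub>C \<i> *\<^sub>C c) \<le> 1"
      using real_dir[OF le] real_dir[OF le'] by blast+
    have "2 *\<^sub>R (1 + z *\<^sub>C c) = (1 + complex_of_real (2 * Re z) *\<^sub>C c)
        + (1 + complex_of_real (2 * Im z) *\<^sub>C \<i> *\<^sub>C c)"
    proof -
      have "2 * z = complex_of_real (2 * Re z) + complex_of_real (2 * Im z) * \<i>"
        by (simp add: complex_eq_iff)
      then have "(2 * z) *\<^sub>C c = complex_of_real (2 * Re z) *\<^sub>C c + complex_of_real (2 * Im z) *\<^sub>C \<i> *\<^sub>C c"
        by (simp only: scaleC_scaleC scaleC_add_left)
      moreover have "2 *\<^sub>R (z *\<^sub>C c) = (2 * z) *\<^sub>C c"
        by (simp add: scaleR_scaleC scaleC_scaleC)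
      ultimately show ?thesis by (simp add: scaleR_add_right scaleR_2)
    qed
    also have "norm \<dots> \<le> 1 + 1"
      by (rule norm_triangle_le[OF add_mono[OF b]])
    finally show ?thesis by simp
  qed
  have bound: "real k * norm c \<le> 2" if "k \<ge> 1" for k
  proof -
    \<comment> \<open>Weighting by the k-th power of each root makes the m-th term survive exactly
      when \<open>N\<close> divides \<open>m + k\<close>. For \<open>m \<le> k\<close> and
      \<open>N = k + 1\<close> this singles out the linear term.\<close>
    define N where "N = k + 1"
    define \<zeta> where "\<zeta> = cis (2 * pi / real N)"
    \<comment> \<open>Halving \<open>c\<close> brings the products with roots of unity into the disc
      on which \<open>disc\<close> gives the bound.\<close>
    define d where "d = (1/2 :: complex) *\<^sub>C c"
    have N: "N > 0" "N \<ge> 2" using that by (auto simp: N_def)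
    have scale_power: "(z *\<^sub>C x) ^ m = z ^ m *\<^sub>C x ^ m" for z m and x :: 'a
      by (induction m) (auto simp: scaleC_one mult_scaleC_left mult_scaleC_right scaleC_scaleC mult_ac)
    have expand: "(1 + z *\<^sub>C d) ^ k = (\<Sum>m\<le>k. (of_nat (k choose m) * z ^ m) *\<^sub>C d ^ m)" for z
    proof -
      have one_plus: "(1 + y) ^ j = (\<Sum>m\<le>j. of_nat (j choose m) * y ^ m)" for y :: 'a and j
      proof (induction j)
        case (Suc j)
        have "(\<Sum>m\<le>Suc j. of_nat (Suc j choose m) * y ^ m)
          = 1 + (\<Sum>m\<le>j. of_nat (j choose Suc m) * y ^ Suc m) + (\<Sum>m\<le>j. of_nat (j choose m) * y ^ Suc m)"
          by (subst sum.atMost_Suc_shift) (simp add: sum.distrib algebra_simps)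
        also have "1 + (\<Sum>m\<le>j. of_nat (j choose Suc m) * y ^ Suc m)
          = (\<Sum>m\<le>Suc j. of_nat (j choose m) * y ^ m)"
          by (subst sum.atMost_Suc_shift) simp
        also have "\<dots> = (1 + y) ^ j" by (simp add: Suc binomial_eq_0)
        also have "(\<Sum>m\<le>j. of_nat (j choose m) * y ^ Suc m) = (1 + y) ^ j * y"
          by (simp add: Suc sum_distrib_right mult.assoc power_commutes)
        finally show ?case by (simp only: power_Suc2 distrib_left mult_1_right)
      qed simp
      have nat_scale: "of_nat i * x = of_nat i *\<^sub>C x" for i and x :: 'a
        by (metis of_real_of_nat_eq scaleR_conv_of_real scaleR_scaleC)
      show ?thesis by (simp add: one_plus scale_power nat_scale scaleC_scaleC)
    qed
    have avg: "(\<Sum>j<N. (\<zeta> ^ j) ^ k *\<^sub>C (1 + \<zeta> ^ j *\<^sub>C d) ^ k) = (of_nat N * of_nat k) *\<^sub>C d"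
    proof -
      have "(\<Sum>j<N. (\<zeta> ^ j) ^ k *\<^sub>C (1 + \<zeta> ^ j *\<^sub>C d) ^ k)
        = (\<Sum>j<N. \<Sum>m\<le>k. (of_nat (k choose m) * (\<zeta> ^ (m + k)) ^ j) *\<^sub>C d ^ m)"
        by (simp add: expand cvec.scale_sum_right scaleC_scaleC mult_ac power_add power_mult_distrib
            add_mult_distrib2 flip: power_mult)
      also have "\<dots> = (\<Sum>m\<le>k. (of_nat (k choose m) * (\<Sum>j<N. (\<zeta> ^ (m + k)) ^ j)) *\<^sub>C d ^ m)"
        by (subst sum.swap) (simp add: sum_distrib_left cvec.scale_sum_left)
      also have "\<dots> = (\<Sum>m\<le>k. if m = 1 then (of_nat N * of_nat k) *\<^sub>C d else 0)"
      proof (rule sum.cong)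
        fix m assume "m \<in> {..k}"
        then have "N dvd m + k \<longleftrightarrow> m = 1"
        proof -
          have "m \<le> k" using \<open>m \<in> {..k}\<close> by simp
          show ?thesis
          proof
            assume "N dvd m + k"
            then obtain q where q: "m + k = (k + 1) * q" by (auto simp: N_def dvd_def)
            have "q = 1"
            proof (rule ccontr)
              assume "q \<noteq> 1"
              then consider "q = 0" | "q \<ge> 2" by linarith
              then show False
              proof cases
                case 2
                then have "(k + 1) * 2 \<le> (k + 1) * q" by (intro mult_left_mono) auto
                then have "(k + 1) * 2 \<le> m + k" by (simp only: q)
                then show False using \<open>m \<le> k\<close> by simp
              qed (use q that in auto)
            qed
            then show "m = 1" using q by simp
          qed (simp add: N_def)
        qed
        then show "(of_nat (k choose m) * (\<Sum>j<N. (\<zeta> ^ (m + k)) ^ j)) *\<^sub>C d ^ m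
          = (if m = 1 then (of_nat N * of_nat k) *\<^sub>C d else 0)"
          unfolding \<zeta>_def using sum_powers_root_of_unity[OF N(1), of "m + k"]
          by (simp add: mult.commute)
      qed simp
      finally show ?thesis using that by simp
    qed
    have "norm (\<Sum>j<N. (\<zeta> ^ j) ^ k *\<^sub>C (1 + \<zeta> ^ j *\<^sub>C d) ^ k) \<le> (\<Sum>j<N. 1)"
    proof (intro sum_norm_le)
      fix j
      have "norm (1 + \<zeta> ^ j *\<^sub>C d) \<le> 1"
        using disc[of "\<zeta> ^ j * (1/2)"] by (simp add: d_def scaleC_scaleC \<zeta>_def norm_mult norm_power)
      then have "norm ((1 + \<zeta> ^ j *\<^sub>C d) ^ k) \<le> 1"
        using norm_power_ineq[of "1 + \<zeta> ^ j *\<^sub>C d" k] by (meson norm_ge_zero order_trans power_le_one)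
      then show "norm ((\<zeta> ^ j) ^ k *\<^sub>C (1 + \<zeta> ^ j *\<^sub>C d) ^ k) \<le> 1"
        by (simp add: norm_scaleC \<zeta>_def norm_power)
    qed
    then have "real N * (real k * norm c) \<le> real N * 2"
      unfolding avg by (simp add: norm_scaleC d_def norm_mult)
    then show ?thesis using N by simp
  qed
  show ?thesis
  proof (rule ccontr)
    assume "c \<noteq> 0"
    then obtain k :: nat where k: "2 < real k * norm c"
      using reals_Archimedean3[of "norm c"] by auto
    then have "k \<ge> 1" by (cases k) auto
    with bound[of k] k show False by simp
  qed
qed

section \<open>Cuntz relations and the finite-dimensional cores\<close>

locale cuntz =
  fixes n :: nat and S :: "nat \<Rightarrow> 'a :: cstar_algebra"
  assumes n_ge_2: "n \<ge> 2" and cuntz_algebra: "cuntz_algebra n S"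
begin

declare One_nat_def [simp del]

lemma isometry: "i \<in> {1..n} \<Longrightarrow> star (S i) * S i = 1"
  using cuntz_algebra by (simp add: cuntz_algebra_def cuntz_relations_def)

lemma sum_range_projections: "(\<Sum>i=1..n. S i * star (S i)) = 1"
  using cuntz_algebra by (simp add: cuntz_algebra_def cuntz_relations_def)

lemma norm_S: "i \<in> {1..n} \<Longrightarrow> norm (S i) = 1"
  using isometry norm_isometry by blast

text \<open>
  The elements \<open>b j = S i* S j S j* S i\<close> with \<open>j \<noteq> i\<close> sum to zero and satisfy \<open>\<parallel>1 - b j\<parallel> \<le> 1\<close>;
  so a suitable multiple \<open>c\<close> of each satisfies \<open>\<parallel>1 \<plusminus> c\<parallel> \<le> 1\<close> and vanishes by extremality of the unit.
\<close>

lemma orthogonal_ranges: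
  assumes i: "i \<in> {1..n}" and j: "j \<in> {1..n}" and "i \<noteq> j"
  shows "star (S i) * S j = 0"
proof -
  define b where "b l = star (S i) * (S l * star (S l)) * S i" for l
  have "(\<Sum>l=1..n. b l) = 1"
    unfolding b_def
    by (simp add: isometry[OF i] sum_range_projections flip: sum_distrib_left sum_distrib_right)
  moreover have bi: "b i = 1"
    by (simp add: b_def isometry[OF i] mult.assoc)
  ultimately have "(\<Sum>l\<in>{1..n} - {i}. b l) = 0"
    using i by (simp add: sum_diff1)
  moreover define J where "J = {1..n} - {i} - {j}"
  ultimately have sumJ: "b j + (\<Sum>l\<in>J. b l) = 0"
    using j \<open>i \<noteq> j\<close> by (simp add: sum.remove[of "{1..n} - {i}" j] J_def)
  \<comment> \<open>\<open>1 - b l\<close> is the compression by the isometry \<open>S i\<close> of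
    the projection complementary to the range of \<open>S l\<close>.\<close>
  have b_le: "norm (1 - b l) \<le> 1" if l: "l \<in> {1..n}" for l
  proof -
    define q where "q = 1 - S l * star (S l)"
    have "S l * star (S l) * (S l * star (S l)) = S l * (star (S l) * S l) * star (S l)"
      by (simp add: mult.assoc)
    then have "q * q = q" by (simp add: q_def algebra_simps isometry[OF l])
    moreover have "star q = q" by (simp add: q_def star_diff star_one star_mult star_star)
    ultimately have "norm q \<le> 1" by (intro norm_projection_le_1)
    moreover have "1 - b l = star (S i) * q * S i"
      by (simp add: b_def q_def algebra_simps isometry[OF i])
    moreover have "norm (star (S i) * q * S i) \<le> norm (star (S i)) * norm q * norm (S i)"
      by (meson mult_right_mono norm_ge_zero norm_mult_ineq order_trans)
    ultimately show ?thesis using norm_S[OF i] by simp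
  qed
  have sa: "star (b l) = b l" for l
    by (simp add: b_def star_mult star_star mult.assoc)
  have "b j = 0"
  proof (cases "J = {}")
    case False
    define m where "m = real (card J)"
    have "card J \<noteq> 0" using False by (simp add: J_def)
    then have m: "m \<ge> 1" by (simp add: m_def)
    define c where "c = (1 / m) *\<^sub>R b j"
    \<comment> \<open>Since \<open>b j\<close> is minus the sum over \<open>J\<close>,
      \<open>1 + c\<close> is the average of the contractions \<open>1 - b l\<close> over
      \<open>J\<close>. Below, \<open>1 - c\<close> is a convex combination of 1 and
      \<open>1 - b j\<close>.\<close>
    have "m *\<^sub>R (1 + c) = (\<Sum>l\<in>J. 1 - b l)"
    proof -
      have "b j = - (\<Sum>l\<in>J. b l)" using sumJ by (simp add: eq_neg_iff_add_eq_0)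
      moreover have "m *\<^sub>R (1 + c) = of_nat (card J) + b j"
        using m by (simp add: c_def scaleR_add_right) (simp add: m_def scaleR_conv_of_real)
      ultimately show ?thesis by (simp add: sum_subtractf)
    qed
    moreover have "norm (\<Sum>l\<in>J. 1 - b l) \<le> (\<Sum>l\<in>J. 1)"
      by (intro sum_norm_le b_le) (auto simp: J_def)
    ultimately have "norm (m *\<^sub>R (1 + c)) \<le> m" by (simp add: m_def)
    then have "norm (1 + c) \<le> 1" using m by simp
    moreover have "norm (1 - c) \<le> 1"
    proof -
      have "1 - c = (1 - 1 / m) *\<^sub>R 1 + (1 / m) *\<^sub>R (1 - b j)"
        by (simp add: c_def scaleR_diff_right scaleR_diff_left)
      also have "norm \<dots> \<le> (1 - 1 / m) + 1 / m"
        using m b_le[OF j] by (intro norm_triangle_mono) (auto simp: divide_le_eq_1 divide_right_mono)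
      finally show ?thesis by simp
    qed
    moreover have "star c = c" by (simp add: c_def scaleR_scaleC star_scaleC sa)
    ultimately have "c = 0" by (intro selfadjoint_eq_0)
    then show ?thesis using m by (simp add: c_def)
  qed (use sumJ in simp)
  moreover have "b j = star (star (S j) * S i) * (star (S j) * S i)"
    by (simp add: b_def star_mult star_star mult.assoc)
  ultimately have "star (S j) * S i = 0"
    using cstar_identity[of "star (S j) * S i"] by simp
  then have "star (star (S j) * S i) = 0" by simp
  then show ?thesis by (simp add: star_mult star_star)
qed

lemma star_S_S: "i \<in> {1..n} \<Longrightarrow> j \<in> {1..n} \<Longrightarrow> star (S i) * S j = (if i = j then 1 else 0)"
  using isometry orthogonal_ranges by auto

lemma star_S_S_assoc:
  "i \<in> {1..n} \<Longrightarrow> j \<in> {1..n} \<Longrightarrow> star (S i) * (S j * x) = (if i = j then x else 0)"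
  using star_S_S[of i j] by (simp flip: mult.assoc)

text \<open>Inserting the sum of the range projections on both sides identifies the algebra with n
  by n matrices over itself. Most later identities are checked entry by entry.\<close>

lemma matrix_expansion:
  "x = (\<Sum>i=1..n. \<Sum>j=1..n. S i * (star (S i) * x * S j) * star (S j))"
proof -
  have "(\<Sum>i=1..n. \<Sum>j=1..n. S i * (star (S i) * x * S j) * star (S j))
    = (\<Sum>i=1..n. S i * star (S i)) * x * (\<Sum>j=1..n. S j * star (S j))"
    by (simp add: sum_distrib_left sum_distrib_right mult.assoc) (rule sum.swap)
  then show ?thesis by (simp add: sum_range_projections)
qed

lemma matrix_eqI:
  assumes "\<And>i j. i \<in> {1..n} \<Longrightarrow> j \<in> {1..n} \<Longrightarrow> star (S i) * x * S j = star (S i) * y * S j"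
  shows "x = y"
  by (subst (1) matrix_expansion, subst (2) matrix_expansion) (intro sum.cong refl, simp add: assms)

section \<open>The canonical shift\<close>

abbreviation \<phi> :: "'a \<Rightarrow> 'a" where "\<phi> \<equiv> canonical_shift n S"

abbreviation word :: "nat list \<Rightarrow> 'a" where "word a \<equiv> prod_list (map S a)"

lemma shift_mult_S: "i \<in> {1..n} \<Longrightarrow> \<phi> x * S i = S i * x"
  by (simp add: canonical_shift_def sum_distrib_right mult.assoc star_S_S if_distrib cong: if_cong)

lemma star_S_mult_shift: "i \<in> {1..n} \<Longrightarrow> star (S i) * \<phi> x = x * star (S i)"
  by (simp add: canonical_shift_def sum_distrib_left mult.assoc star_S_S_assoc if_distrib cong: if_cong)

lemma shift_compress:
  "i \<in> {1..n} \<Longrightarrow> j \<in> {1..n} \<Longrightarrow> star (S i) * \<phi> x * S j = (if i = j then x else 0)"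
  by (simp add: star_S_mult_shift mult.assoc star_S_S)

text \<open>In the matrix picture \<open>\<phi> x\<close> is diagonal with \<open>x\<close> in every
  diagonal entry, so multiplicativity can be read off the entries.\<close>

lemma unital_star_hom_shift: "unital_star_hom_on UNIV \<phi>"
proof -
  have "\<phi> (x * y) = \<phi> x * \<phi> y" for x y
  proof (rule matrix_eqI)
    fix i j assume ij: "i \<in> {1..n}" "j \<in> {1..n}"
    have "star (S i) * (\<phi> x * \<phi> y) * S j = (star (S i) * \<phi> x) * (\<phi> y * S j)"
      by (simp add: mult.assoc)
    also have "\<dots> = x * (star (S i) * S j) * y"
      using ij by (simp add: star_S_mult_shift shift_mult_S mult.assoc)
    finally show "star (S i) * \<phi> (x * y) * S j = star (S i) * (\<phi> x * \<phi> y) * S j"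
      using ij by (simp add: shift_compress star_S_S)
  qed
  moreover have "\<phi> (x + y) = \<phi> x + \<phi> y" "\<phi> (c *\<^sub>C x) = c *\<^sub>C \<phi> x" "\<phi> (star x) = star (\<phi> x)" for x y c
    by (simp_all add: canonical_shift_def algebra_simps sum.distrib mult_scaleC_left mult_scaleC_right
        cvec.scale_sum_right star_sum star_mult star_star)
  moreover have "\<phi> 1 = 1" by (simp add: canonical_shift_def sum_range_projections)
  ultimately show ?thesis by (simp add: unital_star_hom_on_def)
qed

lemma shift_simps:
  "\<phi> 1 = 1" "\<phi> (x + y) = \<phi> x + \<phi> y" "\<phi> (x * y) = \<phi> x * \<phi> y" "\<phi> (c *\<^sub>C x) = c *\<^sub>C \<phi> x"
  "\<phi> (star x) = star (\<phi> x)"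
  using unital_star_hom_shift by (auto simp: unital_star_hom_on_def)

lemma shift_power_simps:
  "(\<phi> ^^ k) 1 = 1" "(\<phi> ^^ k) (x + y) = (\<phi> ^^ k) x + (\<phi> ^^ k) y"
  "(\<phi> ^^ k) (x * y) = (\<phi> ^^ k) x * (\<phi> ^^ k) y" "(\<phi> ^^ k) (c *\<^sub>C x) = c *\<^sub>C (\<phi> ^^ k) x"
  "(\<phi> ^^ k) (star x) = star ((\<phi> ^^ k) x)"
  by (induction k) (simp_all add: shift_simps)

lemma unital_star_subalgebra_UNIV: "unital_star_subalgebra (UNIV :: 'a set)"
  by (simp add: unital_star_subalgebra_def)

lemma norm_shift_power_le: "norm ((\<phi> ^^ k) x) \<le> norm x"
proof (induction k)
  case (Suc k)
  have "norm (\<phi> y) \<le> norm y" for y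
    by (rule star_hom_contractive[OF unital_star_subalgebra_UNIV closed_UNIV unital_star_hom_shift UNIV_I])
  from this[of "(\<phi> ^^ k) x"] Suc show ?case by simp
qed simp

lemma unitary_shift_power: "unitary x \<Longrightarrow> unitary ((\<phi> ^^ k) x)"
  unfolding unitary_def by (metis shift_power_simps(1,3,5))

lemma shift_power_mult_word:
  "set a \<subseteq> {1..n} \<Longrightarrow> (\<phi> ^^ length a) x * word a = word a * x"
proof (induction a arbitrary: x)
  case (Cons i a)
  have "(\<phi> ^^ length (i # a)) x * word (i # a) = \<phi> ((\<phi> ^^ length a) x) * S i * word a"
    by (simp add: mult.assoc)
  also have "\<dots> = S i * ((\<phi> ^^ length a) x * word a)"
    using Cons.prems by (simp only: shift_mult_S mult.assoc set_simps insert_subset)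
  finally show ?case using Cons by (simp add: mult.assoc)
qed simp

section \<open>The finite-dimensional cores\<close>

abbreviation F :: "nat \<Rightarrow> 'a set" where "F \<equiv> fin_core n S"

lemma subspace_fin_core: "cvec.subspace (F k)"
  unfolding fin_core_def by (rule cvec.subspace_span)

lemmas fin_core_add = cvec.subspace_add[OF subspace_fin_core]
lemmas fin_core_scale = cvec.subspace_scale[OF subspace_fin_core]
lemmas fin_core_zero = cvec.subspace_0[OF subspace_fin_core]
lemmas fin_core_sum = cvec.subspace_sum[OF subspace_fin_core]

lemma fin_core_0: "F 0 = range (\<lambda>c. c *\<^sub>C 1)"
proof -
  have "{word a * star (word b) | a b. length a = 0 \<and> length b = 0 \<and> set a \<subseteq> {1..n} \<and> set b \<subseteq> {1..n}}
    = {1}" by (auto simp: star_one)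
  then show ?thesis by (simp add: fin_core_def cvec.span_singleton)
qed

lemma word_in_fin_core:
  "length a = k \<Longrightarrow> length b = k \<Longrightarrow> set a \<subseteq> {1..n} \<Longrightarrow> set b \<subseteq> {1..n} \<Longrightarrow>
    word a * star (word b) \<in> F k"
  unfolding fin_core_def by (intro cvec.span_base) blast

lemma S_fin_core_S:
  assumes "x \<in> F k" "i \<in> {1..n}" "j \<in> {1..n}" shows "S i * x * star (S j) \<in> F (Suc k)"
  using assms(1) unfolding fin_core_def[of _ _ k]
proof (induction rule: cvec.span_induct)
  case base
  show ?case
    by (simp add: cvec.subspace_def algebra_simps mult_scaleC_left mult_scaleC_right
        fin_core_add fin_core_scale fin_core_zero)
next
  case (step x)
  then obtain a b where ab: "x = word a * star (word b)" "length a = k" "length b = k"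
    "set a \<subseteq> {1..n}" "set b \<subseteq> {1..n}" by blast
  have "S i * x * star (S j) = word (i # a) * star (word (j # b))"
    by (simp add: ab star_mult mult.assoc)
  moreover have "\<dots> \<in> F (Suc k)"
    using ab assms(2,3) by (intro word_in_fin_core) auto
  ultimately show ?case by simp
qed

text \<open>Taking an entry strips the first letters of the two words, and
  \<open>matrix_expansion\<close> puts them back. This recursion turns the facts about
  \<open>F k\<close> below into inductions on \<open>k\<close>.\<close>

lemma fin_core_Suc_iff:
  "x \<in> F (Suc k) \<longleftrightarrow> (\<forall>i\<in>{1..n}. \<forall>j\<in>{1..n}. star (S i) * x * S j \<in> F k)"
proof
  assume "x \<in> F (Suc k)"
  then show "\<forall>i\<in>{1..n}. \<forall>j\<in>{1..n}. star (S i) * x * S j \<in> F k"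
    unfolding fin_core_def[of _ _ "Suc k"]
  proof (induction rule: cvec.span_induct)
    case base
    show ?case
      by (simp add: cvec.subspace_def algebra_simps mult_scaleC_left mult_scaleC_right
          fin_core_add fin_core_scale fin_core_zero)
  next
    case (step x)
    then obtain a b where ab: "x = word a * star (word b)" "length a = Suc k" "length b = Suc k"
      "set a \<subseteq> {1..n}" "set b \<subseteq> {1..n}" by blast
    then obtain a0 a' b0 b' where c: "a = a0 # a'" "b = b0 # b'"
      by (metis length_Suc_conv)
    have m: "word a' * star (word b') \<in> F k"
      using ab c by (intro word_in_fin_core) auto
    show ?case
    proof (intro ballI)
      fix i j assume ij: "i \<in> {1..n}" "j \<in> {1..n}"
      have "star (S i) * x * S j = (star (S i) * S a0) * (word a' * star (word b')) * (star (S b0) * S j)"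
        by (simp add: ab(1) c star_mult mult.assoc)
      also have "\<dots> \<in> F k"
        using ab c ij m by (auto simp: star_S_S fin_core_zero)
      finally show "star (S i) * x * S j \<in> F k" .
    qed
  qed
next
  assume "\<forall>i\<in>{1..n}. \<forall>j\<in>{1..n}. star (S i) * x * S j \<in> F k"
  then show "x \<in> F (Suc k)"
    by (subst matrix_expansion) (intro fin_core_sum S_fin_core_S, auto)
qed

lemma fin_core_mono_Suc: "x \<in> F k \<Longrightarrow> x \<in> F (Suc k)"
proof (induction k arbitrary: x)
  case 0
  then obtain c where "x = c *\<^sub>C 1" by (auto simp: fin_core_0)
  then show ?case
    by (auto simp: fin_core_Suc_iff fin_core_0 mult_scaleC_left mult_scaleC_right star_S_S
        intro: range_eqI[of _ _ "0 :: complex"])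
next
  case (Suc k)
  show ?case unfolding fin_core_Suc_iff[of _ "Suc k"]
    using Suc.prems Suc.IH unfolding fin_core_Suc_iff[of x k] by blast
qed

lemma fin_core_mono: "k \<le> l \<Longrightarrow> x \<in> F k \<Longrightarrow> x \<in> F l"
  by (induction rule: dec_induct) (auto intro: fin_core_mono_Suc)

lemma fin_core_one: "1 \<in> F k"
  by (rule fin_core_mono[of 0]) (auto simp: fin_core_0 intro: range_eqI[of _ _ 1])

lemma fin_core_mult: "x \<in> F k \<Longrightarrow> y \<in> F k \<Longrightarrow> x * y \<in> F k"
proof (induction k arbitrary: x y)
  case 0
  then show ?case by (auto simp: fin_core_0 mult_scaleC_left mult_scaleC_right scaleC_scaleC)
next
  case (Suc k)
  show ?case unfolding fin_core_Suc_iff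
  proof (intro ballI)
    fix i j assume ij: "i \<in> {1..n}" "j \<in> {1..n}"
    have "star (S i) * (x * y) * S j = star (S i) * x * (\<Sum>l=1..n. S l * star (S l)) * y * S j"
      by (simp only: sum_range_projections mult_1_right mult.assoc)
    also have "\<dots> = (\<Sum>l=1..n. (star (S i) * x * S l) * (star (S l) * y * S j))"
      by (simp only: sum_distrib_left sum_distrib_right mult.assoc)
    also have "\<dots> \<in> F k"
      using Suc.prems ij by (intro fin_core_sum Suc.IH[of "star (S i) * x * S _" "star (S _) * y * S j"])
        (auto simp: fin_core_Suc_iff)
    finally show "star (S i) * (x * y) * S j \<in> F k" .
  qed
qed

lemma fin_core_star: "x \<in> F k \<Longrightarrow> star x \<in> F k"
proof (induction k arbitrary: x)
  case 0
  then show ?case by (auto simp: fin_core_0 star_scaleC star_one)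
next
  case (Suc k)
  show ?case unfolding fin_core_Suc_iff
  proof (intro ballI)
    fix i j assume ij: "i \<in> {1..n}" "j \<in> {1..n}"
    have "star (star (S j) * x * S i) \<in> F k"
      using Suc.prems ij by (intro Suc.IH) (auto simp: fin_core_Suc_iff)
    then show "star (S i) * star x * S j \<in> F k"
      by (simp add: star_mult star_star mult.assoc)
  qed
qed

lemma fin_core_shift: "x \<in> F k \<Longrightarrow> \<phi> x \<in> F (Suc k)"
  by (auto simp: fin_core_Suc_iff shift_compress fin_core_zero)

lemma fin_core_shift_power: "x \<in> F k \<Longrightarrow> (\<phi> ^^ m) x \<in> F (k + m)"
  by (induction m) (auto intro: fin_core_shift)

text \<open>In the tensor picture the two elements live on disjoint sets of factors. Formally, the
  shifted element is diagonal with equal entries, and by induction these commute with every entry of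
  \<open>x\<close>.\<close>

lemma fin_core_commute: "x \<in> F k \<Longrightarrow> x * (\<phi> ^^ k) y = (\<phi> ^^ k) y * x"
proof (induction k arbitrary: x)
  case 0
  then show ?case by (auto simp: fin_core_0 mult_scaleC_left mult_scaleC_right)
next
  case (Suc k)
  show ?case
  proof (rule matrix_eqI)
    fix i j assume ij: "i \<in> {1..n}" "j \<in> {1..n}"
    have "star (S i) * (x * (\<phi> ^^ Suc k) y) * S j = (star (S i) * x * S j) * (\<phi> ^^ k) y"
      using ij by (simp add: shift_mult_S mult.assoc)
    also have "\<dots> = (\<phi> ^^ k) y * (star (S i) * x * S j)"
      using Suc.prems ij by (intro Suc.IH) (auto simp: fin_core_Suc_iff)
    also have "\<dots> = star (S i) * ((\<phi> ^^ Suc k) y * x) * S j"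
      using ij by (simp add: star_S_mult_shift flip: mult.assoc)
    finally show "star (S i) * (x * (\<phi> ^^ Suc k) y) * S j = star (S i) * ((\<phi> ^^ Suc k) y * x) * S j" .
  qed
qed

section \<open>The UHF core\<close>

abbreviation core :: "'a set" where "core \<equiv> uhf_core n S"

lemma fin_core_subset_core: "x \<in> F k \<Longrightarrow> x \<in> core"
proof -
  assume "x \<in> F k"
  \<comment> \<open>The union defining \<open>uhf_core\<close> starts at 1, so \<open>F 0\<close> is
    reached through \<open>F (Suc 0)\<close>.\<close>
  then have "x \<in> (\<Union>k\<in>{1..}. F k)"
    by (intro UN_I[of "Suc k"] fin_core_mono_Suc) (simp_all add: One_nat_def)
  then show ?thesis unfolding uhf_core_def by (rule closure_subset[THEN subsetD])
qed

lemma core_approx: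
  assumes "x \<in> core" "e > 0" obtains k y where "y \<in> F k" "norm (x - y) < e"
proof -
  obtain y where "y \<in> (\<Union>k\<in>{1..}. F k)" "dist y x < e"
    using assms unfolding uhf_core_def closure_approachable by blast
  then show ?thesis using that by (auto simp: dist_norm norm_minus_commute)
qed

lemma closed_core: "closed core"
  by (simp add: uhf_core_def)

lemma unital_star_subalgebra_core: "unital_star_subalgebra core"
  unfolding uhf_core_def
proof (rule unital_star_subalgebra_closure)
  have "\<exists>m\<ge>1. x \<in> F m \<and> y \<in> F m" if "x \<in> F k" "y \<in> F l" "k \<ge> 1" for x y k l
    using that by (intro exI[of _ "max k l"]) (auto intro: fin_core_mono[rotated])
  then show "unital_star_subalgebra (\<Union>k\<in>{1..}. F k)"
    unfolding unital_star_subalgebra_def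
    by (auto intro: fin_core_one fin_core_scale fin_core_star)
      (metis fin_core_add fin_core_mult atLeast_iff)+
qed

section \<open>Product automorphisms of the core\<close>

definition unitary_seq :: "(nat \<Rightarrow> 'a) \<Rightarrow> bool"
  where "unitary_seq u \<longleftrightarrow> (\<forall>i\<ge>1. u i \<in> F 1 \<and> unitary (u i))"

abbreviation U :: "(nat \<Rightarrow> 'a) \<Rightarrow> nat \<Rightarrow> 'a" where "U \<equiv> elem_tensor n S"

lemma elem_tensor_0: "U x 0 = 1"
  by (simp add: elem_tensor_def One_nat_def)

lemma elem_tensor_Suc: "U x (Suc k) = U x k * (\<phi> ^^ k) (x (Suc k))"
  by (simp add: elem_tensor_def One_nat_def)

lemma unitary_seq_star: "unitary_seq u \<Longrightarrow> unitary_seq (\<lambda>i. star (u i))"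
  by (simp add: unitary_seq_def fin_core_star unitary_star)

lemma elem_tensor_in_fin_core: "unitary_seq u \<Longrightarrow> U u k \<in> F k"
proof (induction k)
  case 0
  show ?case by (simp add: elem_tensor_0 fin_core_one)
next
  case (Suc k)
  then have "(\<phi> ^^ k) (u (Suc k)) \<in> F (1 + k)"
    by (intro fin_core_shift_power) (simp add: unitary_seq_def One_nat_def)
  with Suc show ?case
    by (simp add: elem_tensor_Suc fin_core_mult fin_core_mono_Suc One_nat_def)
qed

lemma unitary_elem_tensor: "unitary_seq u \<Longrightarrow> unitary (U u k)"
proof (induction k)
  case (Suc k)
  then show ?case
    unfolding elem_tensor_Suc
    by (intro unitary_mult unitary_shift_power) (simp_all add: unitary_seq_def One_nat_def)
qed (simp add: elem_tensor_0)

text \<open>The adjoint reverses the order of the factors; the order is restored because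
  \<open>star (U u k)\<close> lies in \<open>F k\<close> and commutes with the image of the k-th
  power of the shift.\<close>

lemma elem_tensor_star: "unitary_seq u \<Longrightarrow> U (\<lambda>i. star (u i)) k = star (U u k)"
proof (induction k)
  case (Suc k)
  have "star (U u (Suc k)) = (\<phi> ^^ k) (star (u (Suc k))) * star (U u k)"
    by (simp add: elem_tensor_Suc star_mult shift_power_simps)
  also have "\<dots> = star (U u k) * (\<phi> ^^ k) (star (u (Suc k)))"
    using fin_core_commute[OF fin_core_star[OF elem_tensor_in_fin_core[OF Suc.prems, of k]]] by simp
  finally show ?case using Suc by (simp add: elem_tensor_Suc)
qed (simp add: elem_tensor_0 star_one)

text \<open>Each further factor of \<open>U u m\<close> is shifted beyond \<open>F k\<close>, so it
  commutes with \<open>x\<close> and cancels against its adjoint.\<close>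

lemma conjugate_stable:
  assumes u: "unitary_seq u" and x: "x \<in> F k" and "k \<le> m"
  shows "U u m * x * star (U u m) = U u k * x * star (U u k)"
  using \<open>k \<le> m\<close>
proof (induction rule: dec_induct)
  case (step m)
  define v where "v = (\<phi> ^^ m) (u (Suc m))"
  have "v * star v = 1"
    using unitary_shift_power[of "u (Suc m)" m] u by (simp add: v_def unitary_def unitary_seq_def One_nat_def)
  moreover have "v * x = x * v"
    unfolding v_def using fin_core_commute[OF fin_core_mono[OF step(1) x]] by simp
  ultimately have "v * x * star v = x" by (simp add: mult.assoc)
  moreover have "U u (Suc m) * x * star (U u (Suc m)) = U u m * (v * x * star v) * star (U u m)"
    by (simp add: elem_tensor_Suc v_def star_mult mult.assoc)
  ultimately show ?case using step by simp
qed simp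

text \<open>A concrete candidate for the map that \<open>product_automorphism\<close> only
  describes. The limit is shown to exist on the core in \<open>\<alpha>_tendsto\<close>.\<close>

definition \<alpha> :: "(nat \<Rightarrow> 'a) \<Rightarrow> 'a \<Rightarrow> 'a"
  where "\<alpha> u x = lim (\<lambda>m. U u m * x * star (U u m))"

text \<open>The sequence is eventually constant for elements of any \<open>F k\<close>. Since all
  conjugations are isometric, it is Cauchy at norm limits of such elements too.\<close>

lemma \<alpha>_tendsto:
  assumes u: "unitary_seq u" and x: "x \<in> core"
  shows "(\<lambda>m. U u m * x * star (U u m)) \<longlonglongrightarrow> \<alpha> u x"
proof -
  have "Cauchy (\<lambda>m. U u m * x * star (U u m))"
  proof (rule metric_CauchyI)
    fix e :: real assume "e > 0"
    then obtain k y where y: "y \<in> F k" "norm (x - y) < e / 2"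
      using core_approx[OF x, of "e / 2"] half_gt_zero by blast
    have close: "norm (U u m * x * star (U u m) - U u k * y * star (U u k)) < e / 2" if "m \<ge> k" for m
    proof -
      have "U u m * x * star (U u m) - U u k * y * star (U u k) = U u m * (x - y) * star (U u m)"
        unfolding conjugate_stable[OF u y(1) that, symmetric] by (simp add: algebra_simps)
      then show ?thesis using y(2) norm_unitary_conjugate[OF unitary_elem_tensor[OF u]] by simp
    qed
    have "dist (U u m * x * star (U u m)) (U u l * x * star (U u l)) < e" if "m \<ge> k" "l \<ge> k" for m l
      using close[OF that(1)] close[OF that(2)]
        dist_triangle2[of "U u m * x * star (U u m)" "U u l * x * star (U u l)" "U u k * y * star (U u k)"]
      by (simp only: dist_norm)
    then show "\<exists>M. \<forall>m\<ge>M. \<forall>l\<ge>M. dist (U u m * x * star (U u m)) (U u l * x * star (U u l)) < e"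
      by blast
  qed
  then show ?thesis
    unfolding \<alpha>_def by (simp add: Cauchy_convergent_iff convergent_LIMSEQ_iff)
qed

lemma \<alpha>_eqI:
  assumes "unitary_seq u" "x \<in> core" "(\<lambda>m. U u m * x * star (U u m)) \<longlonglongrightarrow> l" shows "\<alpha> u x = l"
  using LIMSEQ_unique[OF \<alpha>_tendsto[OF assms(1,2)] assms(3)] .

lemma \<alpha>_fin_core:
  assumes u: "unitary_seq u" and x: "x \<in> F k" shows "\<alpha> u x = U u k * x * star (U u k)"
proof (rule \<alpha>_eqI[OF u fin_core_subset_core[OF x]])
  have "\<forall>\<^sub>F m in sequentially. U u m * x * star (U u m) = U u k * x * star (U u k)"
    unfolding eventually_sequentially using conjugate_stable[OF u x] by blast
  then show "(\<lambda>m. U u m * x * star (U u m)) \<longlonglongrightarrow> U u k * x * star (U u k)"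
    by (rule tendsto_eventually)
qed

lemma \<alpha>_in_core:
  assumes u: "unitary_seq u" and x: "x \<in> core" shows "\<alpha> u x \<in> core"
proof (rule closed_sequentially[OF closed_core _ \<alpha>_tendsto[OF u x]])
  show "U u m * x * star (U u m) \<in> core" for m
    using unital_star_subalgebra_core x fin_core_subset_core[OF elem_tensor_in_fin_core[OF u]]
    by (simp add: unital_star_subalgebra_def)
qed

text \<open>By \<open>elem_tensor_star\<close> the two conjugations cancel exactly at every stage
  \<open>m\<close>; \<open>conjugate_limit\<close> allows the inner limit to be replaced by its m-th
  approximant.\<close>

lemma \<alpha>_star_seq:
  assumes u: "unitary_seq u" and x: "x \<in> core" shows "\<alpha> (\<lambda>i. star (u i)) (\<alpha> u x) = x"
proof -
  note us = unitary_seq_star[OF u]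
  have cancel: "U (\<lambda>i. star (u i)) m * (U u m * x * star (U u m)) * star (U (\<lambda>i. star (u i)) m) = x" for m
  proof -
    have "U (\<lambda>i. star (u i)) m * (U u m * x * star (U u m)) * star (U (\<lambda>i. star (u i)) m)
      = (star (U u m) * U u m) * x * (star (U u m) * U u m)"
      by (simp add: elem_tensor_star[OF u] star_star mult.assoc)
    then show ?thesis using unitary_elem_tensor[OF u, of m] by (simp add: unitary_def)
  qed
  have "(\<lambda>m. U (\<lambda>i. star (u i)) m * (U u m * x * star (U u m)) * star (U (\<lambda>i. star (u i)) m))
      \<longlonglongrightarrow> \<alpha> (\<lambda>i. star (u i)) (\<alpha> u x)"
    by (rule conjugate_limit[OF unitary_elem_tensor[OF us] \<alpha>_tendsto[OF u x] \<alpha>_tendsto[OF us \<alpha>_in_core[OF u x]]])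
  then show ?thesis unfolding cancel by (simp add: LIMSEQ_const_iff)
qed

lemma \<alpha>_star_seq':
  assumes u: "unitary_seq u" and x: "x \<in> core" shows "\<alpha> u (\<alpha> (\<lambda>i. star (u i)) x) = x"
  using \<alpha>_star_seq[OF unitary_seq_star[OF u] x] by (simp add: star_star)

lemma star_automorphism_\<alpha>:
  assumes u: "unitary_seq u" shows "star_automorphism_on core (\<alpha> u)"
proof -
  note C = unital_star_subalgebra_core[unfolded unital_star_subalgebra_def]
  have W: "star (U u m) * U u m = 1" "U u m * star (U u m) = 1" for m
    using unitary_elem_tensor[OF u, of m] by (auto simp: unitary_def)
  have "unital_star_hom_on core (\<alpha> u)"
    unfolding unital_star_hom_on_def
  proof (intro conjI ballI allI)
    show "\<alpha> u 1 = 1"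
      using C by (intro \<alpha>_eqI[OF u]) (simp_all add: W)
    fix x assume x: "x \<in> core"
    note lx = \<alpha>_tendsto[OF u x]
    show "\<alpha> u (c *\<^sub>C x) = c *\<^sub>C \<alpha> u x" for c
      using C x tendsto_scaleC[OF lx] by (intro \<alpha>_eqI[OF u]) (auto simp: mult_scaleC_left mult_scaleC_right)
    show "\<alpha> u (star x) = star (\<alpha> u x)"
      using C x tendsto_star[OF lx] by (intro \<alpha>_eqI[OF u]) (auto simp: star_mult star_star mult.assoc)
    fix y assume y: "y \<in> core"
    note ly = \<alpha>_tendsto[OF u y]
    show "\<alpha> u (x + y) = \<alpha> u x + \<alpha> u y"
      using C x y tendsto_add[OF lx ly] by (intro \<alpha>_eqI[OF u]) (auto simp: algebra_simps)
    have "U u m * x * star (U u m) * (U u m * y * star (U u m)) = U u m * (x * y) * star (U u m)" for m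
    proof -
      have "U u m * x * star (U u m) * (U u m * y * star (U u m))
        = U u m * x * (star (U u m) * U u m) * y * star (U u m)" by (simp only: mult.assoc)
      then show ?thesis by (simp add: W mult.assoc)
    qed
    with C x y tendsto_mult[OF lx ly] show "\<alpha> u (x * y) = \<alpha> u x * \<alpha> u y"
      by (intro \<alpha>_eqI[OF u]) auto
  qed
  moreover have "bij_betw (\<alpha> u) core core"
    by (rule bij_betwI[where g = "\<alpha> (\<lambda>i. star (u i))"])
      (auto simp: \<alpha>_in_core u unitary_seq_star \<alpha>_star_seq \<alpha>_star_seq')
  ultimately show ?thesis by (simp add: star_automorphism_on_def)
qed

lemma twisted_word_snoc: "twisted_word S u (a @ [i]) = twisted_word S u a * (u (Suc (length a)) * S i)"
proof -
  have "map (\<lambda>j. u (j + 1) * S ((a @ [i]) ! j)) [0..<length a] = map (\<lambda>j. u (j + 1) * S (a ! j)) [0..<length a]"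
    by (simp add: nth_append)
  then have "prod_list (map (\<lambda>j. u (j + 1) * S ((a @ [i]) ! j)) [0..<length a]) = twisted_word S u a"
    by (simp only: twisted_word_def)
  then show ?thesis by (simp add: twisted_word_def[of _ _ "a @ [i]"] One_nat_def)
qed

text \<open>By \<open>shift_power_mult_word\<close> each shifted factor slides past the earlier
  letters and lands in front of the letter it twists. This links conjugation by \<open>U u k\<close>
  to the word formula in \<open>product_automorphism\<close>.\<close>

lemma elem_tensor_mult_word:
  "set a \<subseteq> {1..n} \<Longrightarrow> U u (length a) * word a = twisted_word S u a"
proof (induction a rule: rev_induct)
  case Nil
  show ?case by (simp add: elem_tensor_0 twisted_word_def)
next
  case (snoc i a)
  have "U u (length (a @ [i])) * word (a @ [i])
    = U u (length a) * ((\<phi> ^^ length a) (u (Suc (length a))) * word a) * S i"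
    by (simp add: elem_tensor_Suc mult.assoc)
  also have "\<dots> = U u (length a) * word a * (u (Suc (length a)) * S i)"
    using snoc.prems by (simp add: shift_power_mult_word mult.assoc)
  finally show ?case using snoc by (simp add: twisted_word_snoc)
qed

lemma \<alpha>_word:
  assumes u: "unitary_seq u" and "length a = k" "length b = k" "set a \<subseteq> {1..n}" "set b \<subseteq> {1..n}"
  shows "\<alpha> u (word a * star (word b)) = twisted_word S u a * star (twisted_word S u b)"
proof -
  have "\<alpha> u (word a * star (word b)) = U u k * word a * star (U u k * word b)"
    using \<alpha>_fin_core[OF u word_in_fin_core[OF assms(2-)]] by (simp add: star_mult mult.assoc)
  then show ?thesis using elem_tensor_mult_word[of a u] elem_tensor_mult_word[of b u] assms by simp
qed

text \<open>Linearity gives agreement on the finite cores, and automatic contractivity carries it to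
  the closure. This is the uniqueness behind the definite description in
  \<open>product_automorphism\<close>, where continuity is not assumed.\<close>

lemma unital_star_hom_eq_on_core:
  assumes f: "unital_star_hom_on core f" and g: "unital_star_hom_on core g"
    and eq: "\<And>k a b. k \<ge> 1 \<Longrightarrow> length a = k \<Longrightarrow> length b = k \<Longrightarrow> set a \<subseteq> {1..n} \<Longrightarrow> set b \<subseteq> {1..n} \<Longrightarrow>
      f (word a * star (word b)) = g (word a * star (word b))"
    and x: "x \<in> core"
  shows "f x = g x"
proof -
  note C = unital_star_subalgebra_core[unfolded unital_star_subalgebra_def]
  have fin: "y \<in> core \<and> f y = g y" if "y \<in> F (Suc k)" for y k
    using that unfolding fin_core_def
  proof (induction rule: cvec.span_induct)
    case base
    have z: "0 \<in> core" by (rule fin_core_subset_core[OF fin_core_zero])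
    have h0: "h 0 = 0" if "unital_star_hom_on core h" for h :: "'a \<Rightarrow> 'a"
    proof -
      have "h (0 *\<^sub>C 1) = 0 *\<^sub>C h 1" using that C unfolding unital_star_hom_on_def by blast
      then show ?thesis by simp
    qed
    show ?case
      using f g C z h0[OF f] h0[OF g] by (simp add: cvec.subspace_def unital_star_hom_on_def)
  next
    case (step y)
    then obtain a b where ab: "y = word a * star (word b)" "length a = Suc k" "length b = Suc k"
      "set a \<subseteq> {1..n}" "set b \<subseteq> {1..n}" by blast
    then show ?case
      using eq[of "Suc k" a b] fin_core_subset_core[OF word_in_fin_core[of a "Suc k" b]]
      by (simp add: One_nat_def)
  qed
  have diff: "h (x - y) = h x - h y" if h: "unital_star_hom_on core h" and y: "y \<in> core" for h y
  proof -
    have "h (x + (- 1) *\<^sub>C y) = h x + h ((- 1) *\<^sub>C y)" "h ((- 1) *\<^sub>C y) = (- 1) *\<^sub>C h y"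
      using h C x y unfolding unital_star_hom_on_def by blast+
    then show ?thesis by (simp add: scaleC_one)
  qed
  have "norm (f x - g x) \<le> e" if "e > 0" for e :: real
  proof -
    obtain k y where y: "y \<in> F k" "norm (x - y) < e / 2"
      using core_approx[OF x, of "e / 2"] half_gt_zero[OF \<open>e > 0\<close>] by blast
    \<comment> \<open>The hypothesis \<open>eq\<close> covers only words of positive length, so
      \<open>y\<close> is first moved from \<open>F k\<close> to \<open>F (Suc k)\<close>.\<close>
    then have y': "y \<in> core" "f y = g y" using fin[of y k] fin_core_mono_Suc by auto
    have "x - y = x + (- 1) *\<^sub>C y" by (simp add: scaleC_one)
    then have xy: "x - y \<in> core" using C x y'(1) by metis
    have "norm (f (x - y)) < e / 2" "norm (g (x - y)) < e / 2"
      using star_hom_contractive[OF unital_star_subalgebra_core closed_core f xy]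
        star_hom_contractive[OF unital_star_subalgebra_core closed_core g xy] y(2) by auto
    moreover have "f x - g x = f (x - y) - g (x - y)"
      using diff[OF f y'(1)] diff[OF g y'(1)] y'(2) by simp
    ultimately show ?thesis using norm_triangle_ineq4[of "f (x - y)" "g (x - y)"] by simp
  qed
  then have "norm (f x - g x) \<le> 0" by (rule field_le_epsilon[of _ 0, simplified])
  then show ?thesis by simp
qed

lemma product_automorphism_eq_\<alpha>:
  assumes u: "unitary_seq u" and x: "x \<in> core"
  shows "product_automorphism n S u x = \<alpha> u x"
proof -
  have hom: "unital_star_hom_on core (\<alpha> u)" and bij: "bij_betw (\<alpha> u) core core"
    using star_automorphism_\<alpha>[OF u] by (auto simp: star_automorphism_on_def)
  note C = unital_star_subalgebra_core[unfolded unital_star_subalgebra_def]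
  have "product_automorphism n S u = restrict (\<alpha> u) core"
    unfolding product_automorphism_def
  proof (rule the_equality, intro conjI allI impI)
    have "unital_star_hom_on core (restrict (\<alpha> u) core)"
      using hom C by (simp add: unital_star_hom_on_def)
    then show "star_automorphism_on core (restrict (\<alpha> u) core)"
      using bij by (simp add: star_automorphism_on_def cong: bij_betw_cong)
    fix k :: nat and a b :: "nat list"
    assume ab: "1 \<le> k" "length a = k \<and> length b = k \<and> set a \<subseteq> {1..n} \<and> set b \<subseteq> {1..n}"
    then show "restrict (\<alpha> u) core (word a * star (word b)) = twisted_word S u a * star (twisted_word S u b)"
      using \<alpha>_word[OF u, of a k b] fin_core_subset_core[OF word_in_fin_core[of a k b]] by simp
  next
    fix f
    assume f: "f \<in> extensional core \<and> star_automorphism_on core f \<and>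
      (\<forall>k\<ge>1. \<forall>a b. length a = k \<and> length b = k \<and> set a \<subseteq> {1..n} \<and> set b \<subseteq> {1..n} \<longrightarrow>
        f (word a * star (word b)) = twisted_word S u a * star (twisted_word S u b))"
    show "f = restrict (\<alpha> u) core"
    proof (rule extensionalityI)
      fix y assume y: "y \<in> core"
      have "f y = \<alpha> u y"
        using f \<alpha>_word[OF u]
        by (intro unital_star_hom_eq_on_core[OF _ hom _ y]) (auto simp: star_automorphism_on_def)
      then show "f y = restrict (\<alpha> u) core y" using y by simp
    qed (use f in auto)
  qed simp
  then show ?thesis using x by simp
qed

section \<open>Limits of the cocycle give automorphisms\<close>

abbreviation cocycle :: "(nat \<Rightarrow> 'a) \<Rightarrow> nat \<Rightarrow> 'a" where "cocycle \<equiv> cocycle_tensor n S"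

text \<open>The shift of \<open>U u k\<close> is the tensor with 1 in the first place followed by
  \<open>u 1\<close> up to \<open>u k\<close>; multiplying \<open>U u (Suc k)\<close> by its adjoint
  factor by factor gives the cocycle. In the induction the adjoint commutes past the newest factor
  by \<open>fin_core_commute\<close>.\<close>

lemma cocycle_eq:
  assumes u: "unitary_seq u" shows "cocycle u k = U u (Suc k) * star (\<phi> (U u k))"
proof -
  define d where "d j = (if j = 1 then u 1 else u j * star (u (j - 1)))" for j
  have "U d (Suc k) = U u (Suc k) * star (\<phi> (U u k))"
  proof (induction k)
    case 0
    show ?case by (simp add: elem_tensor_Suc elem_tensor_0 shift_simps star_one d_def One_nat_def)
  next
    case (Suc k)
    have Uk: "U u k \<in> F k" by (rule elem_tensor_in_fin_core[OF u])
    have c1: "star (\<phi> (U u k)) * (\<phi> ^^ Suc k) y = (\<phi> ^^ Suc k) y * star (\<phi> (U u k))" for y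
      by (rule fin_core_commute[OF fin_core_star[OF fin_core_shift[OF Uk]]])
    have "U d (Suc (Suc k)) = U d (Suc k) * (\<phi> ^^ Suc k) (u (Suc (Suc k)) * star (u (Suc k)))"
      by (simp add: elem_tensor_Suc[of d "Suc k"] d_def One_nat_def)
    also have "\<dots> = U u (Suc k) * (\<phi> ^^ Suc k) (u (Suc (Suc k)) * star (u (Suc k))) * star (\<phi> (U u k))"
      unfolding Suc.IH using c1 by (simp add: mult.assoc)
    also have "\<dots> = U u (Suc (Suc k)) * ((\<phi> ^^ Suc k) (star (u (Suc k))) * star (\<phi> (U u k)))"
      by (simp add: elem_tensor_Suc[of u "Suc k"] shift_power_simps shift_simps mult.assoc)
    also have "(\<phi> ^^ Suc k) (star (u (Suc k))) * star (\<phi> (U u k)) = star (\<phi> (U u (Suc k)))"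
      by (simp add: elem_tensor_Suc[of u k] shift_power_simps shift_simps star_mult)
    finally show ?case .
  qed
  then show ?thesis by (simp add: cocycle_tensor_def d_def[abs_def] One_nat_def)
qed

lemma unitary_cocycle: "unitary_seq u \<Longrightarrow> unitary (cocycle u k)"
  using unitary_shift_power[of "U u k" 1]
  by (simp add: cocycle_eq unitary_mult unitary_star unitary_elem_tensor One_nat_def)

lemma cocycle_in_fin_core: "unitary_seq u \<Longrightarrow> cocycle u k \<in> F (Suc k)"
  by (simp add: cocycle_eq fin_core_mult fin_core_star fin_core_shift elem_tensor_in_fin_core)

lemma cocycle_mult_S:
  assumes "unitary_seq u" "i \<in> {1..n}"
  shows "cocycle u k * S i = U u (Suc k) * S i * star (U u k)"
  using assms shift_mult_S[of i "star (U u k)"] by (simp add: cocycle_eq shift_simps mult.assoc)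

lemma cuntz_endo:
  assumes "unitary v"
  shows "unital_star_hom_on UNIV (cuntz_endo n S v)" "i \<in> {1..n} \<Longrightarrow> cuntz_endo n S v (S i) = v * S i"
  using theI'[OF cuntz_endo_ex1[OF cuntz_algebra assms]] by (auto simp: cuntz_endo_def)

lemma unital_star_hom_simps:
  fixes f :: "'a \<Rightarrow> 'a"
  assumes "unital_star_hom_on UNIV f"
  shows "f 1 = 1" "f (x + y) = f x + f y" "f (x * y) = f x * f y" "f (c *\<^sub>C x) = c *\<^sub>C f x"
    "f (star x) = star (f x)" "f 0 = 0" "f (\<Sum>i\<in>I. g i) = (\<Sum>i\<in>I. f (g i))" "norm (f x) \<le> norm x"
proof -
  show f: "f 1 = 1" "f (x + y) = f x + f y" "f (x * y) = f x * f y" "f (c *\<^sub>C x) = c *\<^sub>C f x"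
    "f (star x) = star (f x)" for x y c
    using assms by (auto simp: unital_star_hom_on_def)
  show f0: "f 0 = 0" using f(4)[of 0 0] by simp
  show "f (\<Sum>i\<in>I. g i) = (\<Sum>i\<in>I. f (g i))"
    by (induction I rule: infinite_finite_induct) (auto simp: f f0)
  show "norm (f x) \<le> norm x"
    by (rule star_hom_contractive[OF unital_star_subalgebra_UNIV closed_UNIV assms UNIV_I])
qed

lemma unital_star_hom_eqI:
  assumes "unital_star_hom_on UNIV f" "unital_star_hom_on UNIV g"
    and "\<And>i. i \<in> {1..n} \<Longrightarrow> f (S i) = g (S i)"
  shows "f = g"
proof -
  note f = unital_star_hom_simps[OF assms(1)] and g = unital_star_hom_simps[OF assms(2)]
  have bl: "bounded_linear h" if h: "unital_star_hom_on UNIV h" for h :: "'a \<Rightarrow> 'a"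
    using unital_star_hom_simps[OF h]
    by (intro bounded_linear_intro[where K = 1]) (auto simp: scaleR_scaleC)
  have "closed {x. f x = g x}"
    by (intro closed_Collect_eq linear_continuous_on bl assms)
  moreover have "unital_star_subalgebra {x. f x = g x}"
    by (simp add: unital_star_subalgebra_def f g)
  moreover have "S ` {1..n} \<subseteq> {x. f x = g x}" using assms(3) by auto
  ultimately have "{x. f x = g x} = UNIV"
    using cuntz_algebra unfolding cuntz_algebra_def by blast
  then show ?thesis by auto
qed

text \<open>By \<open>cocycle_mult_S\<close>, products of terms \<open>cocycle u k * S i\<close>
  with descending indices telescope, so the image of \<open>word a\<close> is the limit of
  \<open>U u (m + length a) * word a * star (U u m)\<close>. For two words of equal length the inner
  unitaries cancel, and \<open>conjugate_stable\<close> makes the remaining expression constant in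
  \<open>m\<close>.\<close>

lemma cuntz_endo_on_core:
  assumes u: "unitary_seq u" and v: "cocycle u \<longlonglongrightarrow> v" and x: "x \<in> core"
  shows "cuntz_endo n S v x = \<alpha> u x"
proof -
  define f where "f = cuntz_endo n S v"
  have uv: "unitary v" by (rule unitary_limit[OF unitary_cocycle[OF u] v])
  have f: "unital_star_hom_on UNIV f" and fS: "\<And>i. i \<in> {1..n} \<Longrightarrow> f (S i) = v * S i"
    using cuntz_endo[OF uv] by (auto simp: f_def)
  have W: "star (U u m) * U u m = 1" "U u m * star (U u m) = 1" for m
    using unitary_elem_tensor[OF u, of m] by (auto simp: unitary_def)
  have lim: "(\<lambda>m. U u (m + length a) * word a * star (U u m)) \<longlonglongrightarrow> f (word a)" if "set a \<subseteq> {1..n}" for a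
    using that
  proof (induction a)
    case Nil
    then show ?case using f by (simp add: W unital_star_hom_on_def)
  next
    case (Cons i a)
    have "(\<lambda>m. cocycle u (m + length a) * S i * (U u (m + length a) * word a * star (U u m)))
        \<longlonglongrightarrow> v * S i * f (word a)"
      using Cons by (intro tendsto_mult tendsto_const LIMSEQ_ignore_initial_segment v) auto
    moreover have "cocycle u (m + length a) * S i * (U u (m + length a) * word a * star (U u m))
      = U u (m + length (i # a)) * word (i # a) * star (U u m)" for m
    proof -
      have "cocycle u (m + length a) * S i * (U u (m + length a) * word a * star (U u m))
        = U u (Suc (m + length a)) * S i * (star (U u (m + length a)) * U u (m + length a)) * word a * star (U u m)"
        using Cons.prems by (simp add: cocycle_mult_S[OF u] mult.assoc)
      then show ?thesis by (simp add: W mult.assoc)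
    qed
    moreover have "v * S i * f (word a) = f (word (i # a))"
      using Cons.prems fS f by (simp add: unital_star_hom_on_def)
    ultimately show ?case by simp
  qed
  have "f x = \<alpha> u x"
  proof (rule unital_star_hom_eq_on_core[OF _ _ _ x])
    show "unital_star_hom_on core f" using f by (simp add: unital_star_hom_on_def)
    show "unital_star_hom_on core (\<alpha> u)"
      using star_automorphism_\<alpha>[OF u] by (simp add: star_automorphism_on_def)
    fix k a b assume ab: "length a = k" "length b = k" "set a \<subseteq> {1..n}" "set b \<subseteq> {1..n}"
    have "(\<lambda>m. (U u (m + k) * word a * star (U u m)) * star (U u (m + k) * word b * star (U u m)))
      \<longlonglongrightarrow> f (word a) * star (f (word b))"
      using lim[OF ab(3)] lim[OF ab(4)] ab(1,2) by (intro tendsto_mult tendsto_star) auto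
    moreover have "(U u (m + k) * word a * star (U u m)) * star (U u (m + k) * word b * star (U u m))
      = \<alpha> u (word a * star (word b))" for m
    proof -
      have "(U u (m + k) * word a * star (U u m)) * star (U u (m + k) * word b * star (U u m))
        = U u (m + k) * word a * (star (U u m) * U u m) * star (word b) * star (U u (m + k))"
        by (simp add: star_mult star_star mult.assoc)
      also have "\<dots> = U u k * (word a * star (word b)) * star (U u k)"
        using conjugate_stable[OF u word_in_fin_core[OF ab], of "m + k"] by (simp add: W mult.assoc)
      finally show ?thesis using \<alpha>_fin_core[OF u word_in_fin_core[OF ab]] by simp
    qed
    ultimately have "f (word a) * star (f (word b)) = \<alpha> u (word a * star (word b))"
      by (simp add: LIMSEQ_const_iff)
    then show "f (word a * star (word b)) = \<alpha> u (word a * star (word b))"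
      using f by (simp add: unital_star_hom_on_def)
  qed
  then show ?thesis by (simp add: f_def)
qed

text \<open>The cocycle of the inverse sequence is \<open>Ad (U (k+1))*\<close> applied to the adjoint cocycle.\<close>

lemma cocycle_star_tendsto:
  assumes u: "unitary_seq u" and v: "cocycle u \<longlonglongrightarrow> v" "v \<in> core"
  shows "cocycle (\<lambda>i. star (u i)) \<longlonglongrightarrow> \<alpha> (\<lambda>i. star (u i)) (star v)"
proof -
  note us = unitary_seq_star[OF u]
  have "star v \<in> core" using unital_star_subalgebra_core v(2) by (simp add: unital_star_subalgebra_def)
  then have "(\<lambda>m. U (\<lambda>i. star (u i)) (Suc m) * star v * star (U (\<lambda>i. star (u i)) (Suc m)))
      \<longlonglongrightarrow> \<alpha> (\<lambda>i. star (u i)) (star v)"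
    by (intro LIMSEQ_Suc \<alpha>_tendsto[OF us])
  then have "(\<lambda>m. U (\<lambda>i. star (u i)) (Suc m) * star (cocycle u m) * star (U (\<lambda>i. star (u i)) (Suc m)))
      \<longlonglongrightarrow> \<alpha> (\<lambda>i. star (u i)) (star v)"
    by (intro conjugate_limit[OF unitary_elem_tensor[OF us] tendsto_star[OF v(1)]])
  moreover have "U (\<lambda>i. star (u i)) (Suc m) * star (cocycle u m) * star (U (\<lambda>i. star (u i)) (Suc m))
      = cocycle (\<lambda>i. star (u i)) m" for m
  proof -
    have "star (U u (Suc m)) * (\<phi> (U u m) * star (U u (Suc m))) * U u (Suc m)
      = star (U u (Suc m)) * \<phi> (U u m) * (star (U u (Suc m)) * U u (Suc m))"
      by (simp only: mult.assoc)
    then show ?thesis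
      using unitary_elem_tensor[OF u, of "Suc m"]
      by (simp add: cocycle_eq u us elem_tensor_star star_mult star_star shift_simps unitary_def)
  qed
  ultimately show ?thesis by simp
qed

text \<open>The composition sends \<open>S i\<close> to \<open>cuntz_endo n S w v * w * S i\<close>.
  As \<open>v\<close> lies in the core, the endomorphism of \<open>w\<close> acts on it as the
  inverse product automorphism, which sends \<open>star v\<close> to \<open>w\<close>; so the factor
  in front of \<open>S i\<close> is the image of \<open>v * star v\<close>.\<close>

lemma cuntz_endo_inverse:
  assumes u: "unitary_seq u" and v: "cocycle u \<longlonglongrightarrow> v" "v \<in> core"
    and w: "w = \<alpha> (\<lambda>i. star (u i)) (star v)"
  shows "cuntz_endo n S w (cuntz_endo n S v x) = x"
proof -
  note us = unitary_seq_star[OF u]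
  have cw: "cocycle (\<lambda>i. star (u i)) \<longlonglongrightarrow> w"
    unfolding w by (rule cocycle_star_tendsto[OF u v])
  have uv: "unitary v" by (rule unitary_limit[OF unitary_cocycle[OF u] v(1)])
  have uw: "unitary w" by (rule unitary_limit[OF unitary_cocycle[OF us] cw])
  note f = cuntz_endo[OF uv] and g = cuntz_endo[OF uw]
  have hom: "unital_star_hom_on core (\<alpha> (\<lambda>i. star (u i)))"
    using star_automorphism_\<alpha>[OF us] by (simp add: star_automorphism_on_def)
  have vw: "cuntz_endo n S w v * w = 1"
  proof -
    have sv: "star v \<in> core" "v * star v = 1"
      using unital_star_subalgebra_core v(2) uv by (auto simp: unital_star_subalgebra_def unitary_def)
    have "cuntz_endo n S w v * w = \<alpha> (\<lambda>i. star (u i)) v * \<alpha> (\<lambda>i. star (u i)) (star v)"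
      using cuntz_endo_on_core[OF us cw v(2)] w by simp
    also have "\<dots> = \<alpha> (\<lambda>i. star (u i)) (v * star v)"
      using hom v(2) sv(1) by (simp add: unital_star_hom_on_def)
    finally show ?thesis using hom sv(2) by (simp add: unital_star_hom_on_def)
  qed
  have "(\<lambda>x. cuntz_endo n S w (cuntz_endo n S v x)) = (\<lambda>x. x)"
  proof (rule unital_star_hom_eqI)
    show "unital_star_hom_on UNIV (\<lambda>x. cuntz_endo n S w (cuntz_endo n S v x))"
      using f(1) g(1) by (simp add: unital_star_hom_on_def)
    show "unital_star_hom_on UNIV (\<lambda>x :: 'a. x)" by (simp add: unital_star_hom_on_def)
    fix i assume i: "i \<in> {1..n}"
    then have "cuntz_endo n S w (cuntz_endo n S v (S i)) = cuntz_endo n S w v * w * S i"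
      using f(2) g by (simp add: unital_star_hom_on_def mult.assoc)
    then show "cuntz_endo n S w (cuntz_endo n S v (S i)) = S i" by (simp add: vw)
  qed
  then show ?thesis by meson
qed

theorem cocycle_limit_automorphism:
  assumes u: "unitary_seq u" and v: "cocycle u \<longlonglongrightarrow> v" "v \<in> core"
  shows "unitary v" "star_automorphism_on UNIV (cuntz_endo n S v)"
    "x \<in> core \<Longrightarrow> cuntz_endo n S v x = product_automorphism n S u x"
proof -
  show uv: "unitary v" by (rule unitary_limit[OF unitary_cocycle[OF u] v(1)])
  show "x \<in> core \<Longrightarrow> cuntz_endo n S v x = product_automorphism n S u x"
    using cuntz_endo_on_core[OF u v(1)] product_automorphism_eq_\<alpha>[OF u] by simp
  define w where "w = \<alpha> (\<lambda>i. star (u i)) (star v)"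
  note us = unitary_seq_star[OF u]
  have cw: "cocycle (\<lambda>i. star (u i)) \<longlonglongrightarrow> w"
    unfolding w_def by (rule cocycle_star_tendsto[OF u v])
  have sv: "star v \<in> core" using unital_star_subalgebra_core v(2) by (simp add: unital_star_subalgebra_def)
  have wc: "w \<in> core" unfolding w_def by (rule \<alpha>_in_core[OF us sv])
  have hom: "unital_star_hom_on core (\<alpha> u)"
    using star_automorphism_\<alpha>[OF u] by (simp add: star_automorphism_on_def)
  \<comment> \<open>This recovers \<open>v\<close> from \<open>w\<close> by the same formula for the
    adjoint sequence, so \<open>cuntz_endo_inverse\<close> with exchanged roles gives the other
    composition.\<close>
  have "\<alpha> u (star w) = star (\<alpha> u w)" using hom wc by (simp add: unital_star_hom_on_def)
  also have "\<dots> = v" unfolding w_def by (simp add: \<alpha>_star_seq'[OF u sv] star_star)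
  finally have "v = \<alpha> (\<lambda>i. star (star (u i))) (star w)" by (simp add: star_star)
  then have "cuntz_endo n S v (cuntz_endo n S w x) = x" for x
    by (rule cuntz_endo_inverse[OF us cw wc])
  moreover have "cuntz_endo n S w (cuntz_endo n S v x) = x" for x
    by (rule cuntz_endo_inverse[OF u v w_def])
  ultimately have "bij (cuntz_endo n S v)"
    by (intro o_bij[of "cuntz_endo n S w"]) (auto simp: fun_eq_iff)
  then show "star_automorphism_on UNIV (cuntz_endo n S v)"
    using cuntz_endo(1)[OF uv] by (simp add: star_automorphism_on_def)
qed

section \<open>The KMS state as a norm limit\<close>

text \<open>A contractive unital left inverse of the shift. In the tensor picture of the core it
  applies the normalized trace to the first factor and moves the other factors one place to the
  left.\<close>

definition \<psi> :: "'a \<Rightarrow> 'a"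
  where "\<psi> x = (1 / of_nat n) *\<^sub>C (\<Sum>i=1..n. star (S i) * x * S i)"

lemma \<psi>_simps:
  "\<psi> (x + y) = \<psi> x + \<psi> y" "\<psi> (c *\<^sub>C x) = c *\<^sub>C \<psi> x" "\<psi> (star x) = star (\<psi> x)"
proof -
  show "\<psi> (x + y) = \<psi> x + \<psi> y"
    by (simp add: \<psi>_def distrib_left distrib_right sum.distrib scaleC_add_right)
  show "\<psi> (c *\<^sub>C x) = c *\<^sub>C \<psi> x"
    by (simp add: \<psi>_def mult_scaleC_left mult_scaleC_right scaleC_scaleC flip: cvec.scale_sum_right)
  show "\<psi> (star x) = star (\<psi> x)"
    by (simp add: \<psi>_def star_scaleC star_sum star_mult star_star mult.assoc)
qed

lemma \<psi>_one: "\<psi> 1 = 1"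
proof -
  have "(\<Sum>i=1..n. star (S i) * 1 * S i) = of_nat n *\<^sub>C 1"
    using scaleR_scaleC[of "real n" "1 :: 'a"] by (simp add: isometry scaleR_conv_of_real)
  then show ?thesis using n_ge_2 by (simp add: \<psi>_def scaleC_scaleC scaleC_one)
qed

text \<open>Orthogonality of the ranges leaves a single summand. A leading letter is rotated to the
  end at the price of 1/n; this yields both the decay on words and the KMS condition.\<close>

lemma \<psi>_S_mult: "i \<in> {1..n} \<Longrightarrow> \<psi> (S i * x) = (1 / of_nat n) *\<^sub>C (x * S i)"
proof -
  assume i: "i \<in> {1..n}"
  have "(\<Sum>j=1..n. star (S j) * (S i * x) * S j) = (\<Sum>j=1..n. if j = i then x * S j else 0)"
    using i by (intro sum.cong) (auto simp: star_S_S_assoc)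
  then show ?thesis using i by (simp add: \<psi>_def)
qed

lemma \<psi>_mult_star_S: "i \<in> {1..n} \<Longrightarrow> \<psi> (x * star (S i)) = (1 / of_nat n) *\<^sub>C (star (S i) * x)"
  using \<psi>_S_mult[of i "star x"] \<psi>_simps(3)[of "S i * star x"]
  by (simp add: star_mult star_star star_scaleC)

lemma \<psi>_fin_core: "x \<in> F (Suc k) \<Longrightarrow> \<psi> x \<in> F k"
  unfolding \<psi>_def by (intro fin_core_scale fin_core_sum) (auto simp: fin_core_Suc_iff)

lemma norm_\<psi>_le: "norm (\<psi> x) \<le> norm x"
proof -
  have "norm (star (S i) * x * S i) \<le> norm x" if i: "i \<in> {1..n}" for i
  proof -
    have "norm (star (S i) * x * S i) \<le> norm (star (S i)) * norm x * norm (S i)"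
      by (meson mult_right_mono norm_ge_zero norm_mult_ineq order_trans)
    then show ?thesis by (simp add: norm_S[OF i])
  qed
  then have "norm (\<Sum>i=1..n. star (S i) * x * S i) \<le> (\<Sum>i=1..n. norm x)"
    by (intro sum_norm_le) auto
  then show ?thesis
    using n_ge_2 by (simp add: \<psi>_def norm_scaleC norm_divide field_simps)
qed

lemma \<psi>_power_simps:
  "(\<psi> ^^ k) (x + y) = (\<psi> ^^ k) x + (\<psi> ^^ k) y" "(\<psi> ^^ k) (c *\<^sub>C x) = c *\<^sub>C (\<psi> ^^ k) x"
  "(\<psi> ^^ k) (star x) = star ((\<psi> ^^ k) x)" "(\<psi> ^^ k) 1 = 1"
  by (induction k) (simp_all add: \<psi>_simps \<psi>_one)

lemma \<psi>_power_diff: "(\<psi> ^^ k) (x - y) = (\<psi> ^^ k) x - (\<psi> ^^ k) y"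
  using \<psi>_power_simps(1)[of k x "(- 1) *\<^sub>C y"] \<psi>_power_simps(2)[of k "- 1" y] by (simp add: scaleC_one)

lemma norm_\<psi>_power_le: "norm ((\<psi> ^^ k) x) \<le> norm x"
proof (induction k)
  case (Suc k)
  then show ?case using norm_\<psi>_le[of "(\<psi> ^^ k) x"] by simp
qed simp

lemma \<psi>_power_fin_core: "x \<in> F (j + k) \<Longrightarrow> (\<psi> ^^ k) x \<in> F j"
  by (induction k arbitrary: j) (auto intro!: \<psi>_fin_core)

text \<open>Commuting with the matrix units \<open>S i * star (S j)\<close> forces \<open>h\<close>
  to be diagonal with equal entries, hence \<open>h = \<phi> (\<psi> h)\<close>. The common entry
  \<open>\<psi> h\<close> commutes with the next smaller core, and induction applies.\<close>

lemma shift_\<psi>_commutant: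
  assumes "\<And>x. x \<in> F k \<Longrightarrow> h * x = x * h" shows "(\<phi> ^^ k) ((\<psi> ^^ k) h) = h"
  using assms
proof (induction k arbitrary: h)
  case (Suc k)
  have one: "1 \<in> {1..n}" using n_ge_2 by simp
  have comm1: "h * (S i * y * star (S j)) = S i * y * star (S j) * h"
    if "i \<in> {1..n}" "j \<in> {1..n}" "y \<in> F k" for i j y
    by (rule Suc.prems[OF S_fin_core_S[OF that(3,1,2)]])
  define t where "t = star (S 1) * h * S 1"
  have entry: "star (S i) * h * S j = (if i = j then t else 0)"
    if i: "i \<in> {1..n}" and j: "j \<in> {1..n}" for i j
  proof -
    have "star (S i) * h * S j = star (S i) * (h * (S j * 1 * star (S 1))) * S 1"
      by (simp add: mult.assoc isometry[OF one])
    also have "\<dots> = (star (S i) * S j) * (star (S 1) * h * S 1)"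
      unfolding comm1[OF j one fin_core_one] by (simp add: mult.assoc)
    finally show ?thesis by (simp add: star_S_S[OF i j] t_def)
  qed
  have \<psi>h: "\<psi> h = t"
  proof -
    have "(\<Sum>i=1..n. star (S i) * h * S i) = of_nat n *\<^sub>C t"
      using scaleR_scaleC[of "real n" t]
      by (simp add: entry scaleR_conv_of_real)
    then show ?thesis using n_ge_2 by (simp add: \<psi>_def scaleC_scaleC scaleC_one)
  qed
  have "\<phi> (\<psi> h) = h"
    by (rule matrix_eqI) (simp add: shift_compress \<psi>h entry)
  moreover have "(\<phi> ^^ k) ((\<psi> ^^ k) (\<psi> h)) = \<psi> h"
  proof (rule Suc.IH)
    fix x assume x: "x \<in> F k"
    have "\<psi> h * x = star (S 1) * (h * (S 1 * x * star (S 1))) * S 1"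
      unfolding \<psi>h t_def by (simp add: mult.assoc isometry[OF one])
    also have "\<dots> = (star (S 1) * S 1) * x * (star (S 1) * h * S 1)"
      unfolding comm1[OF one one x] by (simp add: mult.assoc)
    finally show "\<psi> h * x = x * \<psi> h" by (simp add: isometry[OF one] \<psi>h t_def)
  qed
  ultimately show ?case by (simp add: funpow_swap1)
qed simp

lemma isometry_word: "set a \<subseteq> {1..n} \<Longrightarrow> star (word a) * word a = 1"
proof (induction a)
  case (Cons i a)
  have "star (word (i # a)) * word (i # a) = star (word a) * (star (S i) * S i) * word a"
    by (simp add: star_mult mult.assoc)
  with Cons show ?case by (simp add: isometry)
qed (simp add: star_one)

text \<open>Each application rotates the word by one letter, so only the scalar changes and the word
  stays an isometry; this gives geometric decay in norm.\<close>

lemma \<psi>_power_word: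
  assumes "set a \<subseteq> {1..n}" "a \<noteq> []"
  shows "\<exists>b. set b \<subseteq> {1..n} \<and> b \<noteq> [] \<and> (\<psi> ^^ k) (word a) = (1 / of_nat n) ^ k *\<^sub>C word b"
proof (induction k)
  case 0
  show ?case using assms by (auto simp: scaleC_one intro!: exI[of _ a])
next
  case (Suc k)
  then obtain i b where b: "set (i # b) \<subseteq> {1..n}" "(\<psi> ^^ k) (word a) = (1 / of_nat n) ^ k *\<^sub>C word (i # b)"
    by (metis list.exhaust)
  then have "(\<psi> ^^ Suc k) (word a) = (1 / of_nat n) ^ Suc k *\<^sub>C word (b @ [i])"
    by (simp add: \<psi>_simps \<psi>_S_mult scaleC_scaleC mult.commute)
  moreover have "set (b @ [i]) \<subseteq> {1..n}" using b(1) by simp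
  ultimately show ?case by blast
qed

lemma \<psi>_power_word_tendsto_0:
  assumes "set a \<subseteq> {1..n}" "a \<noteq> []" shows "(\<lambda>k. (\<psi> ^^ k) (word a)) \<longlonglongrightarrow> 0"
proof -
  have "norm ((\<psi> ^^ k) (word a)) = (1 / real n) ^ k" for k
  proof -
    obtain b where b: "set b \<subseteq> {1..n}" "(\<psi> ^^ k) (word a) = (1 / of_nat n) ^ k *\<^sub>C word b"
      using \<psi>_power_word[OF assms] by blast
    then show ?thesis
      using norm_isometry[OF isometry_word[OF b(1)]] by (simp add: norm_scaleC norm_power norm_divide)
  qed
  moreover have "(\<lambda>k. (1 / real n) ^ k) \<longlonglongrightarrow> 0"
    using n_ge_2 by (intro LIMSEQ_power_zero) auto
  ultimately show ?thesis by (intro tendsto_norm_zero_cancel[of "\<lambda>k. (\<psi> ^^ k) (word a)"]) simp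
qed

section \<open>Convergence of the iterates on the whole algebra\<close>

definition words :: "'a set"
  where "words = {word a * star (word b) | a b. set a \<subseteq> {1..n} \<and> set b \<subseteq> {1..n}}"

definition \<psi>_converges :: "'a \<Rightarrow> bool"
  where "\<psi>_converges x \<longleftrightarrow> (\<exists>c. (\<lambda>k. (\<psi> ^^ k) x) \<longlonglongrightarrow> c *\<^sub>C 1)"

text \<open>While both words are nonempty, \<psi> strips their first letters with a factor 1/n, or
  gives zero if these differ. Once one word is exhausted, a remaining nonempty word decays to zero,
  and two empty words leave the unit.\<close>

lemma \<psi>_converges_words:
  "set a \<subseteq> {1..n} \<Longrightarrow> set b \<subseteq> {1..n} \<Longrightarrow> \<psi>_converges (word a * star (word b))"
proof (induction b arbitrary: a)
  case Nil
  have "(\<lambda>k. (\<psi> ^^ k) (word a)) \<longlonglongrightarrow> (if a = [] then 1 else 0) *\<^sub>C 1"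
    using \<psi>_power_word_tendsto_0[of a] Nil by (auto simp: \<psi>_power_simps scaleC_one)
  then show ?case unfolding \<psi>_converges_def by (auto simp: star_one)
next
  case (Cons j b)
  show ?case
  proof (cases a)
    case Nil
    have "(\<lambda>k. star ((\<psi> ^^ k) (word (j # b)))) \<longlonglongrightarrow> star 0"
      by (intro tendsto_star \<psi>_power_word_tendsto_0 Cons.prems) simp
    then have "(\<lambda>k. (\<psi> ^^ k) (star (word (j # b)))) \<longlonglongrightarrow> 0 *\<^sub>C 1"
      by (simp only: \<psi>_power_simps star_zero cvec.scale_zero_left)
    then show ?thesis unfolding \<psi>_converges_def Nil by (intro exI[of _ 0]) simp
  next
    case (Cons i a')
    have ij: "i \<in> {1..n}" "j \<in> {1..n}" "set a' \<subseteq> {1..n}" "set b \<subseteq> {1..n}"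
      using Cons.prems Cons by auto
    obtain c where c: "(\<lambda>k. (\<psi> ^^ k) (word a' * star (word b))) \<longlonglongrightarrow> c *\<^sub>C 1"
      using Cons.IH[OF ij(3,4)] by (auto simp: \<psi>_converges_def)
    define d :: complex where "d = (if i = j then 1 / of_nat n else 0)"
    have "\<psi> (word a * star (word (j # b))) = d *\<^sub>C (word a' * star (word b))"
    proof -
      have "\<psi> (word a * star (word (j # b))) = \<psi> (S i * (word a' * star (word b) * star (S j)))"
        by (simp add: Cons star_mult mult.assoc)
      also have "\<dots> = (1 / of_nat n) *\<^sub>C (word a' * star (word b) * (star (S j) * S i))"
        using \<psi>_S_mult[OF ij(1)] by (simp add: mult.assoc)
      finally show ?thesis using star_S_S[OF ij(2,1)] by (auto simp: d_def)
    qed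
    then have "(\<psi> ^^ Suc k) (word a * star (word (j # b))) = d *\<^sub>C (\<psi> ^^ k) (word a' * star (word b))" for k
      by (simp only: funpow_Suc_right o_apply \<psi>_power_simps)
    then have "(\<lambda>k. (\<psi> ^^ Suc k) (word a * star (word (j # b)))) \<longlonglongrightarrow> (d * c) *\<^sub>C 1"
      using tendsto_scaleC[OF c, of d] by (simp only: scaleC_scaleC)
    then show ?thesis unfolding \<psi>_converges_def by (intro exI) (rule LIMSEQ_imp_Suc)
  qed
qed

lemma subspace_\<psi>_converges: "cvec.subspace {x. \<psi>_converges x}"
  unfolding cvec.subspace_def
proof (intro conjI ballI allI)
  show "0 \<in> {x. \<psi>_converges x}"
    using \<psi>_power_simps(2)[of _ 0 0] by (auto simp: \<psi>_converges_def intro!: exI[of _ 0])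
  fix x assume "x \<in> {x. \<psi>_converges x}"
  then obtain c where c: "(\<lambda>k. (\<psi> ^^ k) x) \<longlonglongrightarrow> c *\<^sub>C 1" by (auto simp: \<psi>_converges_def)
  show "d *\<^sub>C x \<in> {x. \<psi>_converges x}" for d
    using tendsto_scaleC[OF c, of d] by (auto simp: \<psi>_converges_def \<psi>_power_simps scaleC_scaleC)
  fix y assume "y \<in> {x. \<psi>_converges x}"
  then obtain d where d: "(\<lambda>k. (\<psi> ^^ k) y) \<longlonglongrightarrow> d *\<^sub>C 1" by (auto simp: \<psi>_converges_def)
  show "x + y \<in> {x. \<psi>_converges x}"
    using tendsto_add[OF c d] by (auto simp: \<psi>_converges_def \<psi>_power_simps simp flip: scaleC_add_left)
qed

lemma \<psi>_limit_le:
  assumes "(\<lambda>k. (\<psi> ^^ k) x) \<longlonglongrightarrow> c *\<^sub>C 1" shows "cmod c \<le> norm x"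
proof -
  have "norm (c *\<^sub>C 1 :: 'a) \<le> norm x"
    by (rule LIMSEQ_le_const2[OF tendsto_norm[OF assms]]) (auto intro: norm_\<psi>_power_le)
  then show ?thesis by (simp add: norm_scaleC)
qed

text \<open>The iterates are contractions uniformly in \<open>k\<close>, so the limiting scalars of
  a convergent sequence are Cauchy, and an epsilon/3 argument exchanges the two limits.\<close>

lemma closed_\<psi>_converges: "closed {x. \<psi>_converges x}"
  unfolding closed_sequential_limits
proof (intro allI impI)
  fix x and l assume A: "(\<forall>j. x j \<in> {x. \<psi>_converges x}) \<and> x \<longlonglongrightarrow> l"
  then have "\<forall>j. \<exists>c. (\<lambda>k. (\<psi> ^^ k) (x j)) \<longlonglongrightarrow> c *\<^sub>C 1" and x: "x \<longlonglongrightarrow> l"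
    by (auto simp: \<psi>_converges_def)
  then obtain c where c: "\<And>j. (\<lambda>k. (\<psi> ^^ k) (x j)) \<longlonglongrightarrow> c j *\<^sub>C 1" by metis
  have dist: "cmod (c i - c j) \<le> norm (x i - x j)" for i j
    using tendsto_diff[OF c[of i] c[of j]]
    by (intro \<psi>_limit_le) (simp add: \<psi>_power_diff cvec.scale_left_diff_distrib)
  have "Cauchy c"
  proof (rule metric_CauchyI)
    fix e :: real assume "e > 0"
    then obtain M where "\<And>i j. i \<ge> M \<Longrightarrow> j \<ge> M \<Longrightarrow> dist (x i) (x j) < e"
      using LIMSEQ_imp_Cauchy[OF x] by (meson metric_CauchyD)
    then show "\<exists>M. \<forall>m\<ge>M. \<forall>k\<ge>M. dist (c m) (c k) < e"
      using dist unfolding dist_norm by (meson le_less_trans)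
  qed
  then obtain d where d: "c \<longlonglongrightarrow> d" by (auto simp: Cauchy_convergent_iff convergent_def)
  have "(\<lambda>k. (\<psi> ^^ k) l) \<longlonglongrightarrow> d *\<^sub>C 1"
  proof (rule LIMSEQ_I)
    fix e :: real assume "e > 0"
    then have e3: "e / 3 > 0" by simp
    have "\<forall>\<^sub>F j in sequentially. dist (x j) l < e / 3 \<and> dist (c j) d < e / 3"
      using tendstoD[OF x e3] tendstoD[OF d e3] by (rule eventually_conj)
    then obtain j where j: "norm (l - x j) < e / 3" "cmod (c j - d) < e / 3"
      using eventually_happens'[OF sequentially_bot] by (auto simp: dist_norm norm_minus_commute)
    obtain M where M: "\<And>k. k \<ge> M \<Longrightarrow> norm ((\<psi> ^^ k) (x j) - c j *\<^sub>C 1) < e / 3"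
      using LIMSEQ_D[OF c[of j] e3] by blast
    have "norm ((\<psi> ^^ k) l - d *\<^sub>C 1) < e" if "k \<ge> M" for k
    proof -
      have "(\<psi> ^^ k) l - d *\<^sub>C 1 = (\<psi> ^^ k) (l - x j) + (((\<psi> ^^ k) (x j) - c j *\<^sub>C 1) + (c j - d) *\<^sub>C 1)"
        by (simp add: \<psi>_power_diff cvec.scale_left_diff_distrib)
      also have "norm \<dots> \<le> norm (l - x j) + (norm ((\<psi> ^^ k) (x j) - c j *\<^sub>C 1) + cmod (c j - d))"
        by (intro norm_triangle_mono norm_\<psi>_power_le) (simp_all add: norm_scaleC)
      finally show ?thesis using j M[OF that] by simp
    qed
    then show "\<exists>M. \<forall>k\<ge>M. norm ((\<psi> ^^ k) l - d *\<^sub>C 1) < e" by blast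
  qed
  then show "l \<in> {x. \<psi>_converges x}" by (auto simp: \<psi>_converges_def)
qed

text \<open>Equal leading letters cancel and different ones give zero. Otherwise one word runs out
  first and what is left of the other remains. Hence the span of \<open>words\<close> is closed
  under products.\<close>

lemma star_word_mult_word:
  "set b \<subseteq> {1..n} \<Longrightarrow> set c \<subseteq> {1..n} \<Longrightarrow>
    \<exists>d. set d \<subseteq> {1..n} \<and> star (word b) * word c \<in> {0, word d, star (word d)}"
proof (induction b arbitrary: c)
  case Nil
  then show ?case by (intro exI[of _ c]) (simp add: star_one)
next
  case (Cons i b)
  show ?case
  proof (cases c)
    case Nil
    then show ?thesis using Cons.prems by (intro exI[of _ "i # b"]) simp
  next
    case (Cons j c')
    have ij: "i \<in> {1..n}" "j \<in> {1..n}" "set b \<subseteq> {1..n}" "set c' \<subseteq> {1..n}"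
      using Cons.prems Cons by auto
    have "star (word (i # b)) * word c = star (word b) * (star (S i) * S j) * word c'"
      by (simp add: Cons star_mult mult.assoc)
    also have "\<dots> = (if i = j then star (word b) * word c' else 0)"
      using star_S_S[OF ij(1,2)] by simp
    finally show ?thesis using Cons.IH[OF ij(3,4)] by auto
  qed
qed

lemma words_mult:
  assumes "x \<in> words" "y \<in> words" shows "x * y \<in> insert 0 words"
proof -
  obtain a b c d where x: "x = word a * star (word b)" "set a \<subseteq> {1..n}" "set b \<subseteq> {1..n}"
    and y: "y = word c * star (word d)" "set c \<subseteq> {1..n}" "set d \<subseteq> {1..n}"
    using assms by (auto simp: words_def)
  obtain e where e: "set e \<subseteq> {1..n}" "star (word b) * word c \<in> {0, word e, star (word e)}"
    using star_word_mult_word[OF x(3) y(2)] by blast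
  have xy: "x * y = word a * (star (word b) * word c) * star (word d)"
    by (simp add: x y mult.assoc)
  consider "star (word b) * word c = 0" | "star (word b) * word c = word e"
    | "star (word b) * word c = star (word e)" using e(2) by blast
  then show ?thesis
  proof cases
    case 2
    then have "x * y = word (a @ e) * star (word d)" by (simp add: xy)
    then have "x * y \<in> words"
      unfolding words_def using x y e(1) by (intro CollectI exI[of _ "a @ e"] exI[of _ d]) simp
    then show ?thesis by simp
  next
    case 3
    then have "x * y = word a * star (word (d @ e))" by (simp add: xy star_mult mult.assoc)
    then have "x * y \<in> words"
      unfolding words_def using x y e(1) by (intro CollectI exI[of _ a] exI[of _ "d @ e"]) simp
    then show ?thesis by simp
  qed (simp add: xy)
qed

lemma unital_star_subalgebra_cspan_words: "unital_star_subalgebra (cspan words)"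
  unfolding unital_star_subalgebra_def
proof (intro conjI ballI allI)
  have "1 = word [] * star (word [])" by (simp add: star_one)
  then show "1 \<in> cspan words" 
    unfolding words_def by (intro cvec.span_base CollectI exI[of _ "[]"]) simp
  fix x assume x: "x \<in> cspan words"
  show "c *\<^sub>C x \<in> cspan words" for c by (rule cvec.span_scale[OF x])
  show "star x \<in> cspan words"
    using x
  proof (induction rule: cvec.span_induct)
    case base
    show ?case by (auto simp: cvec.subspace_def star_add star_scaleC cvec.span_zero cvec.span_add cvec.span_scale)
  next
    case (step x)
    then obtain a b where "x = word a * star (word b)" "set a \<subseteq> {1..n}" "set b \<subseteq> {1..n}"
      by (auto simp: words_def)
    then have "star x \<in> words" by (auto simp: words_def star_mult star_star)
    then show ?case by (rule cvec.span_base)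
  qed
  fix y assume y: "y \<in> cspan words"
  show "x + y \<in> cspan words" by (rule cvec.span_add[OF x y])
  show "x * y \<in> cspan words"
    using x
  proof (induction rule: cvec.span_induct)
    case base
    show ?case by (auto simp: cvec.subspace_def distrib_right mult_scaleC_left cvec.span_zero cvec.span_add cvec.span_scale)
  next
    case (step x)
    show ?case using y
    proof (induction rule: cvec.span_induct)
      case base
      show ?case by (auto simp: cvec.subspace_def distrib_left mult_scaleC_right cvec.span_zero cvec.span_add cvec.span_scale)
    next
      case (step y)
      then have "x * y = 0 \<or> x * y \<in> words" using words_mult[OF \<open>x \<in> words\<close>] by blast
      then show ?case using cvec.span_zero cvec.span_base by metis
    qed
  qed
qed

lemma closure_cspan_words: "closure (cspan words) = UNIV"
proof -
  have "S i \<in> words" if "i \<in> {1..n}" for i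
    unfolding words_def using that by (intro CollectI exI[of _ "[i]"] exI[of _ "[]"]) (simp add: star_one)
  then have "S ` {1..n} \<subseteq> closure (cspan words)"
    using closure_subset cvec.span_superset by blast
  then show ?thesis
    using cuntz_algebra unital_star_subalgebra_closure[OF unital_star_subalgebra_cspan_words]
    unfolding cuntz_algebra_def by (meson closed_closure)
qed

lemma \<psi>_converges: "\<psi>_converges x"
proof -
  have "words \<subseteq> {x. \<psi>_converges x}" using \<psi>_converges_words by (auto simp: words_def)
  then have "cspan words \<subseteq> {x. \<psi>_converges x}"
    by (rule cvec.span_minimal[OF _ subspace_\<psi>_converges])
  then have "closure (cspan words) \<subseteq> {x. \<psi>_converges x}"
    by (rule closure_minimal[OF _ closed_\<psi>_converges])
  then show ?thesis using closure_cspan_words by auto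
qed

section \<open>The state and its KMS condition\<close>

definition \<omega> :: "'a \<Rightarrow> complex"
  where "\<omega> x = (SOME c. (\<lambda>k. (\<psi> ^^ k) x) \<longlonglongrightarrow> c *\<^sub>C 1)"

lemma \<omega>_tendsto: "(\<lambda>k. (\<psi> ^^ k) x) \<longlonglongrightarrow> \<omega> x *\<^sub>C 1"
  unfolding \<omega>_def using \<psi>_converges[of x] unfolding \<psi>_converges_def by (rule someI_ex)

lemma \<omega>_eqI:
  assumes "(\<lambda>k. (\<psi> ^^ k) x) \<longlonglongrightarrow> c *\<^sub>C 1" shows "\<omega> x = c"
proof -
  have "\<omega> x *\<^sub>C 1 = (c *\<^sub>C 1 :: 'a)" by (rule LIMSEQ_unique[OF \<omega>_tendsto assms])
  then have "norm ((\<omega> x - c) *\<^sub>C (1 :: 'a)) = 0" by (simp add: cvec.scale_left_diff_distrib)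
  then show ?thesis by (simp add: norm_scaleC)
qed

lemma \<omega>_add: "\<omega> (x + y) = \<omega> x + \<omega> y"
  using tendsto_add[OF \<omega>_tendsto \<omega>_tendsto]
  by (intro \<omega>_eqI) (simp add: \<psi>_power_simps flip: scaleC_add_left)

lemma \<omega>_scale: "\<omega> (c *\<^sub>C x) = c * \<omega> x"
  using tendsto_scaleC[OF \<omega>_tendsto]
  by (intro \<omega>_eqI) (simp add: \<psi>_power_simps scaleC_scaleC)

lemma \<omega>_one: "\<omega> 1 = 1"
  by (intro \<omega>_eqI) (simp add: \<psi>_power_simps scaleC_one)

lemma \<omega>_diff: "\<omega> (x - y) = \<omega> x - \<omega> y"
  using \<omega>_add[of "x - y" y] by simp

lemma norm_\<omega>_le: "cmod (\<omega> x) \<le> norm x"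
  by (rule \<psi>_limit_le[OF \<omega>_tendsto])

lemma \<omega>_\<psi>: "\<omega> (\<psi> x) = \<omega> x"
  using LIMSEQ_Suc[OF \<omega>_tendsto[of x]] by (intro \<omega>_eqI) (simp add: funpow_swap1)

lemma \<omega>_S_mult: "i \<in> {1..n} \<Longrightarrow> of_nat n * \<omega> (S i * x) = \<omega> (x * S i)"
  using \<omega>_\<psi>[of "S i * x"] n_ge_2 by (simp add: \<psi>_S_mult \<omega>_scale field_simps)

lemma \<omega>_mult_star_S: "i \<in> {1..n} \<Longrightarrow> of_nat n * \<omega> (x * star (S i)) = \<omega> (star (S i) * x)"
  using \<omega>_\<psi>[of "x * star (S i)"] n_ge_2 by (simp add: \<psi>_mult_star_S \<omega>_scale field_simps)

lemma \<omega>_word_mult: "set a \<subseteq> {1..n} \<Longrightarrow> of_nat n ^ length a * \<omega> (word a * x) = \<omega> (x * word a)"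
proof (induction a arbitrary: x)
  case (Cons i a)
  have "of_nat n ^ length (i # a) * \<omega> (word (i # a) * x) = of_nat n ^ length a * (of_nat n * \<omega> (S i * (word a * x)))"
    by (simp add: mult.assoc mult.left_commute)
  also have "\<dots> = of_nat n ^ length a * \<omega> (word a * (x * S i))"
    using Cons.prems \<omega>_S_mult[of i "word a * x"] by (simp add: mult.assoc)
  also have "\<dots> = \<omega> (x * S i * word a)" using Cons by simp
  finally show ?case by (simp add: mult.assoc)
qed simp

lemma \<omega>_mult_star_word:
  "set b \<subseteq> {1..n} \<Longrightarrow> of_nat n ^ length b * \<omega> (x * star (word b)) = \<omega> (star (word b) * x)"
proof (induction b arbitrary: x)
  case (Cons i b)
  have "of_nat n ^ length (i # b) * \<omega> (x * star (word (i # b)))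
    = of_nat n ^ length b * (of_nat n * \<omega> (x * star (word b) * star (S i)))"
    by (simp add: star_mult mult.assoc mult.left_commute)
  also have "\<dots> = of_nat n ^ length b * \<omega> (star (S i) * x * star (word b))"
    using Cons.prems \<omega>_mult_star_S[of i "x * star (word b)"] by (simp add: mult.assoc)
  also have "\<dots> = \<omega> (star (word b) * (star (S i) * x))" using Cons by simp
  finally show ?case by (simp add: star_mult mult.assoc)
qed (simp add: star_one)

text \<open>The algebraic part of the gauge spectral subspace of degree r - s. The integer degree is
  encoded as a pair of naturals so that it can be used in powers of \<open>n\<close>.\<close>

definition homogeneous :: "nat \<Rightarrow> nat \<Rightarrow> 'a set"
  where "homogeneous r s = cspan {word a * star (word b) | a b.
    set a \<subseteq> {1..n} \<and> set b \<subseteq> {1..n} \<and> length a + s = length b + r}"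

text \<open>Moving \<open>word a\<close> from the front to the back and \<open>star (word b)\<close>
  from the back to the front produces powers of \<open>n\<close> whose quotient depends only on the
  degree.\<close>

lemma \<omega>_KMS:
  assumes "x \<in> homogeneous r s"
  shows "of_nat n ^ r * \<omega> (x * y) = of_nat n ^ s * \<omega> (y * x)"
  using assms unfolding homogeneous_def
proof (induction rule: cvec.span_induct)
  case base
  have "\<omega> 0 = 0" using \<omega>_scale[of 0 0] by simp
  then show ?case
    by (simp add: cvec.subspace_def distrib_left distrib_right mult_scaleC_left mult_scaleC_right \<omega>_add \<omega>_scale
        mult.left_commute)
next
  case (step x)
  then obtain a b where ab: "x = word a * star (word b)" "set a \<subseteq> {1..n}" "set b \<subseteq> {1..n}"
    "length a + s = length b + r" by blast
  have "of_nat n ^ length a * \<omega> (x * y) = \<omega> (star (word b) * (y * word a))"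
    using \<omega>_word_mult[OF ab(2), of "star (word b) * y"] by (simp add: ab(1) mult.assoc)
  also have "\<dots> = of_nat n ^ length b * \<omega> (y * x)"
    using \<omega>_mult_star_word[OF ab(3), of "y * word a"] by (simp add: ab(1) mult.assoc)
  finally have "of_nat n ^ (length a + s) * \<omega> (x * y) = of_nat n ^ length b * (of_nat n ^ s * \<omega> (y * x))"
    by (simp add: power_add mult_ac)
  then have "of_nat n ^ length b * (of_nat n ^ r * \<omega> (x * y)) = of_nat n ^ length b * (of_nat n ^ s * \<omega> (y * x))"
    unfolding ab(4) by (simp add: power_add mult_ac)
  then show ?case using n_ge_2 by simp
qed

text \<open>By \<open>shift_\<psi>_commutant\<close>, \<open>h - \<omega> h *\<^sub>C 1\<close> is
  for every \<open>k\<close> the k-fold shift of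
  \<open>(\<psi> ^^ k) h - \<omega> h *\<^sub>C 1\<close>. The shift is contractive and the latter
  tends to zero.\<close>

lemma core_commutant:
  assumes "\<And>k x. x \<in> F k \<Longrightarrow> h * x = x * h" shows "h = \<omega> h *\<^sub>C 1"
proof -
  have "norm (h - \<omega> h *\<^sub>C 1) \<le> norm ((\<psi> ^^ k) h - \<omega> h *\<^sub>C 1)" for k
  proof -
    have "h - \<omega> h *\<^sub>C 1 = (\<phi> ^^ k) ((\<psi> ^^ k) h + (- \<omega> h) *\<^sub>C 1)"
      unfolding shift_power_simps(2,4,1) by (simp add: shift_\<psi>_commutant[OF assms])
    then show ?thesis using norm_shift_power_le[of k "(\<psi> ^^ k) h + (- \<omega> h) *\<^sub>C 1"] by simp
  qed
  moreover have "(\<lambda>k. norm ((\<psi> ^^ k) h - \<omega> h *\<^sub>C 1)) \<longlonglongrightarrow> 0"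
    by (intro tendsto_norm_zero LIM_zero \<omega>_tendsto)
  ultimately have "norm (h - \<omega> h *\<^sub>C 1) \<le> 0"
    by (intro LIMSEQ_le_const) auto
  then show ?thesis by simp
qed

section \<open>The gauge action\<close>

lemma homogeneous_0_in_core:
  assumes "x \<in> homogeneous r r" shows "x \<in> core"
proof -
  note C = unital_star_subalgebra_core[unfolded unital_star_subalgebra_def]
  have "cvec.subspace core"
    unfolding cvec.subspace_def using C fin_core_subset_core[OF fin_core_zero] by blast
  moreover have "{word a * star (word b) | a b.
      set a \<subseteq> {1..n} \<and> set b \<subseteq> {1..n} \<and> length a + r = length b + r} \<subseteq> core"
    using fin_core_subset_core[OF word_in_fin_core] by auto
  ultimately show ?thesis
    using assms cvec.span_minimal unfolding homogeneous_def by blast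
qed

definition gauge :: "complex \<Rightarrow> 'a \<Rightarrow> 'a"
  where "gauge z = cuntz_endo n S (z *\<^sub>C 1)"

lemma gauge:
  assumes "cmod z = 1"
  shows "unital_star_hom_on UNIV (gauge z)" "i \<in> {1..n} \<Longrightarrow> gauge z (S i) = z *\<^sub>C S i"
proof -
  have "cnj z * z = 1" "z * cnj z = 1"
    using assms complex_norm_square[of z] by (simp_all add: mult.commute)
  then have "unitary (z *\<^sub>C 1 :: 'a)"
    by (simp add: unitary_def star_scaleC star_one mult_scaleC_left mult_scaleC_right scaleC_scaleC scaleC_one)
  from cuntz_endo[OF this] show "unital_star_hom_on UNIV (gauge z)"
    "i \<in> {1..n} \<Longrightarrow> gauge z (S i) = z *\<^sub>C S i"
    by (auto simp: gauge_def mult_scaleC_left)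
qed

lemma gauge_word:
  assumes z: "cmod z = 1" and "set a \<subseteq> {1..n}" shows "gauge z (word a) = z ^ length a *\<^sub>C word a"
  using assms(2) by (induction a)
    (auto simp: unital_star_hom_simps[OF gauge(1)[OF z]] gauge(2)[OF z] mult_scaleC_left mult_scaleC_right
      scaleC_scaleC scaleC_one mult.commute)

lemma gauge_fin_core:
  assumes z: "cmod z = 1" shows "x \<in> F k \<Longrightarrow> gauge z x = x"
proof (induction k arbitrary: x)
  note g = unital_star_hom_simps[OF gauge(1)[OF z]]
  case 0
  then show ?case by (auto simp: fin_core_0 g)
next
  note g = unital_star_hom_simps[OF gauge(1)[OF z]]
  case (Suc k)
  have zz: "cnj z * z = 1" using z complex_norm_square[of z] by (simp add: mult.commute)
  show ?case
  proof (rule matrix_eqI)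
    fix i j assume ij: "i \<in> {1..n}" "j \<in> {1..n}"
    have "gauge z (star (S i) * x * S j) = (cnj z * z) *\<^sub>C (star (S i) * gauge z x * S j)"
      using ij by (simp add: g gauge(2)[OF z] star_scaleC mult_scaleC_left mult_scaleC_right scaleC_scaleC mult.commute)
    moreover have "gauge z (star (S i) * x * S j) = star (S i) * x * S j"
      using Suc ij by (simp add: fin_core_Suc_iff)
    ultimately show "star (S i) * gauge z x * S j = star (S i) * x * S j"
      by (simp add: zz scaleC_one)
  qed
qed

text \<open>The bound on the lengths leaves finitely many gauge degrees, which finitely many roots
  of unity can then separate.\<close>

lemma cspan_words_bounded:
  assumes "p \<in> cspan words"
  obtains m where "p \<in> cspan {word a * star (word b) | a b.
    set a \<subseteq> {1..n} \<and> set b \<subseteq> {1..n} \<and> length a \<le> m \<and> length b \<le> m}"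
proof -
  define V where "V m = cspan {word a * star (word b) | a b.
    set a \<subseteq> {1..n} \<and> set b \<subseteq> {1..n} \<and> length a \<le> m \<and> length b \<le> m}" for m
  have mono: "V m \<subseteq> V m'" if "m \<le> m'" for m m'
    unfolding V_def using that by (intro cvec.span_mono) force
  have "\<exists>m. p \<in> V m"
    using assms
  proof (induction rule: cvec.span_induct)
    case base
    have "\<exists>m. x + y \<in> V m" if "x \<in> V m1" "y \<in> V m2" for x y m1 m2
      using mono[of m1 "max m1 m2"] mono[of m2 "max m1 m2"] that
      unfolding V_def by (intro exI[of _ "max m1 m2"] cvec.span_add) auto
    moreover have "0 \<in> V 0" "\<And>c x m. x \<in> V m \<Longrightarrow> c *\<^sub>C x \<in> V m"
      unfolding V_def by (auto intro: cvec.span_zero cvec.span_scale)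
    ultimately show ?case unfolding cvec.subspace_def by blast
  next
    case (step x)
    then obtain a b where ab: "x = word a * star (word b)" "set a \<subseteq> {1..n}" "set b \<subseteq> {1..n}"
      by (auto simp: words_def)
    have "x \<in> V (max (length a) (length b))"
      unfolding V_def using ab by (intro cvec.span_base CollectI exI[of _ a] exI[of _ b]) auto
    then show ?case by blast
  qed
  then show ?thesis using that unfolding V_def by blast
qed

text \<open>
  Spectral averaging over the \<open>N\<close>-th roots of unity projects an approximant of \<open>w\<close> to the
  spectral subspace of \<open>w\<close>; for large \<open>N\<close> only one degree survives.
\<close>

lemma homogeneous_approx:
  assumes eigen: "\<And>z. cmod z = 1 \<Longrightarrow> \<exists>\<mu>. cmod \<mu> = 1 \<and> gauge z w = \<mu> *\<^sub>C w"
    and "w \<noteq> 0" "e > 0"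
  obtains r s q where "q \<in> homogeneous r s" "norm (w - q) < e"
proof -
  obtain p where p: "p \<in> cspan words" "norm (w - p) < e"
    using closure_cspan_words \<open>e > 0\<close> closure_approachable[of w "cspan words"]
    by (auto simp: dist_norm norm_minus_commute)
  obtain m where m: "p \<in> cspan {word a * star (word b) | a b.
      set a \<subseteq> {1..n} \<and> set b \<subseteq> {1..n} \<and> length a \<le> m \<and> length b \<le> m}"
    using cspan_words_bounded[OF p(1)] .
  \<comment> \<open>The degrees in \<open>p\<close> lie between -m and m, so
    \<open>2 * m + 1\<close> roots of unity distinguish them.\<close>
  define N where "N = 2 * m + 1"
  define \<zeta> where "\<zeta> = cis (2 * pi / real N)"
  have N: "N > 0" by (simp add: N_def)
  have \<zeta>: "cmod \<zeta> = 1" "cnj \<zeta> * \<zeta> = 1" "\<zeta> ^ N = 1"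
    using complex_norm_square[of \<zeta>] root_of_unity_eq_iff[OF N, of N 0]
    by (simp_all add: \<zeta>_def mult.commute)
  have cnj_power: "cnj \<zeta> ^ k * \<zeta> ^ k = 1" for k
    by (simp add: \<zeta>(2) flip: power_mult_distrib)
  define \<gamma> where "\<gamma> = gauge \<zeta>"
  note \<gamma> = unital_star_hom_simps[OF gauge(1)[OF \<zeta>(1)], folded \<gamma>_def]
  have \<gamma>_power: "(\<gamma> ^^ j) 1 = 1" "(\<gamma> ^^ j) (x + y) = (\<gamma> ^^ j) x + (\<gamma> ^^ j) y"
    "(\<gamma> ^^ j) (x * y) = (\<gamma> ^^ j) x * (\<gamma> ^^ j) y"
    "(\<gamma> ^^ j) (c *\<^sub>C x) = c *\<^sub>C (\<gamma> ^^ j) x" "(\<gamma> ^^ j) (star x) = star ((\<gamma> ^^ j) x)" for j x y c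
    by (induction j) (simp_all add: \<gamma>)
  have \<gamma>_power_norm: "norm ((\<gamma> ^^ j) x) \<le> norm x" for j x
    by (induction j) (auto intro: order_trans[OF \<gamma>(8)])
  obtain \<mu> where \<mu>: "cmod \<mu> = 1" "\<gamma> w = \<mu> *\<^sub>C w"
    using eigen[OF \<zeta>(1)] by (auto simp: \<gamma>_def)
  have \<mu>\<mu>: "cnj \<mu> * \<mu> = 1" using \<mu>(1) complex_norm_square[of \<mu>] by (simp add: mult.commute)
  have \<gamma>w: "(\<gamma> ^^ j) w = \<mu> ^ j *\<^sub>C w" for j
    by (induction j) (simp_all add: \<gamma> \<mu>(2) scaleC_scaleC scaleC_one mult.commute)
  have \<gamma>N: "(\<gamma> ^^ N) x = x" for x
  proof -
    have "(\<gamma> ^^ j) (S i) = \<zeta> ^ j *\<^sub>C S i" if "i \<in> {1..n}" for i j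
      by (induction j) (simp_all add: \<gamma> gauge(2)[OF \<zeta>(1) that, folded \<gamma>_def] scaleC_scaleC scaleC_one mult.commute)
    then have "\<gamma> ^^ N = (\<lambda>x. x)"
      by (intro unital_star_hom_eqI) (auto simp: unital_star_hom_on_def \<gamma>_power \<zeta>(3) scaleC_one)
    then show ?thesis by simp
  qed
  \<comment> \<open>A contractive projection onto the \<mu>-eigenspace of \<gamma>: it fixes
    \<open>w\<close> and annihilates the eigenvectors of other eigenvalues, all of which are N-th
    roots of unity.\<close>
  define T where "T x = (1 / of_nat N) *\<^sub>C (\<Sum>j<N. cnj \<mu> ^ j *\<^sub>C (\<gamma> ^^ j) x)" for x
  have T_add: "T (x + y) = T x + T y" and T_scale: "T (c *\<^sub>C x) = c *\<^sub>C T x" for x y c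
  proof -
    show "T (x + y) = T x + T y"
      by (simp add: T_def \<gamma>_power scaleC_add_right sum.distrib)
    show "T (c *\<^sub>C x) = c *\<^sub>C T x"
      by (simp add: T_def \<gamma>_power scaleC_scaleC cvec.scale_sum_right mult.commute mult.left_commute)
  qed
  have T_norm: "norm (T x) \<le> norm x" for x
  proof -
    have "norm (\<Sum>j<N. cnj \<mu> ^ j *\<^sub>C (\<gamma> ^^ j) x) \<le> (\<Sum>j<N. norm x)"
      by (intro sum_norm_le) (simp add: norm_scaleC norm_power \<mu>(1) \<gamma>_power_norm)
    then show ?thesis using N by (simp add: T_def norm_scaleC norm_divide field_simps)
  qed
  have Tw: "T w = w"
  proof -
    have "(cnj \<mu> ^ j * \<mu> ^ j) = 1" for j by (simp add: \<mu>\<mu> flip: power_mult_distrib)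
    then have "(\<Sum>j<N. cnj \<mu> ^ j *\<^sub>C (\<gamma> ^^ j) w) = of_nat N *\<^sub>C w"
      using scaleR_scaleC[of "real N" w] by (simp add: \<gamma>w scaleC_scaleC scaleC_one scaleR_conv_of_real)
    then show ?thesis using N by (simp add: T_def scaleC_scaleC scaleC_one)
  qed
  have root: "c ^ N = 1" if "\<gamma> x = c *\<^sub>C x" "x \<noteq> 0" for c x
  proof -
    have "(\<gamma> ^^ j) x = c ^ j *\<^sub>C x" for j
      by (induction j) (simp_all add: \<gamma> that(1) scaleC_scaleC scaleC_one mult.commute)
    then have "(c ^ N - 1) *\<^sub>C x = 0"
      using \<gamma>N[of x] by (simp add: cvec.scale_left_diff_distrib scaleC_one)
    then show ?thesis using that(2) by simp
  qed
  have T_eigen: "T x = (if t = \<mu> then x else 0)" if t: "\<gamma> x = t *\<^sub>C x" for x t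
  proof (cases "x = 0")
    case True
    then show ?thesis using T_scale[of 0 0] by simp
  next
    case False
    have pow: "(\<gamma> ^^ j) x = t ^ j *\<^sub>C x" for j
      by (induction j) (simp_all add: \<gamma> t scaleC_scaleC scaleC_one mult.commute)
    define a where "a = cnj \<mu> * t"
    have "a ^ N = cnj (\<mu> ^ N) * t ^ N" by (simp add: a_def power_mult_distrib)
    also have "\<dots> = 1"
      using root[OF t False] root[OF \<mu>(2) \<open>w \<noteq> 0\<close>] by simp
    finally have aN: "a ^ N = 1" .
    have "\<mu> * a = (cnj \<mu> * \<mu>) * t" by (simp only: a_def mult_ac)
    then have "\<mu> * a = t" by (simp only: \<mu>\<mu> mult_1_left)
    then have a1: "a = 1 \<longleftrightarrow> t = \<mu>"
      using \<mu>(1) by auto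
    have "(\<Sum>j<N. cnj \<mu> ^ j *\<^sub>C (\<gamma> ^^ j) x) = (\<Sum>j<N. a ^ j) *\<^sub>C x"
      by (simp add: pow scaleC_scaleC a_def power_mult_distrib cvec.scale_sum_left)
    moreover have "(\<Sum>j<N. a ^ j) = (if t = \<mu> then of_nat N else 0)"
      using a1 aN by (auto simp: geometric_sum)
    ultimately show ?thesis using N by (simp add: T_def scaleC_scaleC scaleC_one)
  qed
  \<comment> \<open>All word degrees with eigenvalue \<mu> coincide; r - s is that degree. If none
    has this eigenvalue, the condition is vacuous and 0, 0 serves.\<close>
  obtain r s where rs: "\<And>k l. k \<le> m \<Longrightarrow> l \<le> m \<Longrightarrow> \<zeta> ^ k * cnj \<zeta> ^ l = \<mu> \<Longrightarrow> k + s = l + r"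
  proof (cases "\<exists>r s. r \<le> m \<and> s \<le> m \<and> \<zeta> ^ r * cnj \<zeta> ^ s = \<mu>")
    case True
    then obtain r s where rs: "r \<le> m" "s \<le> m" "\<zeta> ^ r * cnj \<zeta> ^ s = \<mu>" by blast
    have "k + s = l + r" if kl: "k \<le> m" "l \<le> m" "\<zeta> ^ k * cnj \<zeta> ^ l = \<mu>" for k l
    proof -
      have "\<zeta> ^ (k + s) = (\<zeta> ^ k * cnj \<zeta> ^ l) * \<zeta> ^ (l + s)"
        using cnj_power[of l] by (simp add: power_add mult_ac)
      also have "\<dots> = \<zeta> ^ (l + r)"
        unfolding kl(3) rs(3)[symmetric] using cnj_power[of s] by (simp add: power_add mult_ac)
      \<comment> \<open>Both sums are at most \<open>2 * m\<close>, hence below \<open>N\<close>, so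
        the congruence is an equality.\<close>
      finally have "(k + s) mod N = (l + r) mod N"
        unfolding \<zeta>_def root_of_unity_eq_iff[OF N] .
      then show ?thesis using kl rs by (simp add: N_def)
    qed
    then show ?thesis using that by blast
  next
    case False
    then show ?thesis using that[of 0 0] by blast
  qed
  have "T p \<in> homogeneous r s"
    using m
  proof (induction rule: cvec.span_induct)
    case base
    have "T 0 = 0" using T_scale[of 0 0] by simp
    then show ?case
      unfolding homogeneous_def
      by (auto simp: cvec.subspace_def T_add T_scale cvec.span_zero cvec.span_add cvec.span_scale)
  next
    case (step x)
    then obtain a b where ab: "x = word a * star (word b)" "set a \<subseteq> {1..n}" "set b \<subseteq> {1..n}"
      "length a \<le> m" "length b \<le> m" by blast
    have "\<gamma> x = (\<zeta> ^ length a * cnj \<zeta> ^ length b) *\<^sub>C x"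
      using ab gauge_word[OF \<zeta>(1)]
      by (simp add: \<gamma> \<gamma>_def[symmetric] star_scaleC mult_scaleC_left mult_scaleC_right scaleC_scaleC mult.commute)
    then have T: "T x = (if \<zeta> ^ length a * cnj \<zeta> ^ length b = \<mu> then x else 0)"
      by (rule T_eigen)
    show ?case
    proof (cases "\<zeta> ^ length a * cnj \<zeta> ^ length b = \<mu>")
      case True
      then have "length a + s = length b + r" using rs ab by blast
      then have "x \<in> homogeneous r s"
        unfolding homogeneous_def using ab by (intro cvec.span_base) blast
      then show ?thesis by (simp add: T True)
    next
      case False
      then show ?thesis by (simp add: T homogeneous_def cvec.span_zero)
    qed
  qed
  moreover have "norm (w - T p) < e"
  proof -
    have "T (w - p) + T p = w" using T_add[of "w - p" p] Tw by simp
    then have "T (w - p) = w - T p" by (simp add: eq_diff_eq)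
    then show ?thesis using T_norm[of "w - p"] p(2) by simp
  qed
  ultimately show ?thesis using that by blast
qed

text \<open>For a homogeneous approximant \<open>q\<close>, the KMS condition relates
  \<open>\<omega> (q * star w)\<close> and \<open>\<omega> (star w * q)\<close> by a power of
  \<open>n\<close>. Both values are near 1, so the power is trivial, \<open>q\<close> has degree
  zero and lies in the core.\<close>

lemma eigenvector_in_core:
  assumes w: "unitary w"
    and eigen: "\<And>z. cmod z = 1 \<Longrightarrow> \<exists>\<mu>. cmod \<mu> = 1 \<and> gauge z w = \<mu> *\<^sub>C w"
  shows "w \<in> core"
proof -
  have w0: "w \<noteq> 0" using norm_unitary[OF w] by auto
  have "\<exists>q\<in>core. norm (w - q) < e" if "e > 0" for e
  proof -
    \<comment> \<open>The tolerance 1/4 keeps both moduli in [3/4, 5/4], so their ratio stays below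
      2, which is at most \<open>n\<close>.\<close>
    define d where "d = min e (1/4)"
    have "d > 0" using \<open>e > 0\<close> by (simp add: d_def)
    then obtain r s q where q: "q \<in> homogeneous r s" "norm (w - q) < d"
      using homogeneous_approx[OF eigen w0] by blast
    have close: "cmod (\<omega> (q * star w) - 1) \<le> 1/4" "cmod (\<omega> (star w * q) - 1) \<le> 1/4"
    proof -
      have "\<omega> (q * star w) - 1 = \<omega> ((q - w) * star w)" "\<omega> (star w * q) - 1 = \<omega> (star w * (q - w))"
        using w by (simp_all add: algebra_simps \<omega>_diff \<omega>_one unitary_def)
      moreover have "norm ((q - w) * star w) \<le> 1/4" "norm (star w * (q - w)) \<le> 1/4"
        using q(2) by (simp_all add: norm_unitary_mult_left norm_unitary_mult_right unitary_star w
            norm_minus_commute d_def)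
      ultimately show "cmod (\<omega> (q * star w) - 1) \<le> 1/4" "cmod (\<omega> (star w * q) - 1) \<le> 1/4"
        using norm_\<omega>_le order_trans by metis+
    qed
    define A B where "A = \<omega> (q * star w)" and "B = \<omega> (star w * q)"
    have AB: "of_nat n ^ r * A = of_nat n ^ s * B"
      unfolding A_def B_def by (rule \<omega>_KMS[OF q(1)])
    have b: "3/4 \<le> cmod A" "cmod A \<le> 5/4" "3/4 \<le> cmod B" "cmod B \<le> 5/4"
      using close norm_triangle_ineq2[of 1 A] norm_triangle_ineq2[of A 1]
        norm_triangle_ineq2[of 1 B] norm_triangle_ineq2[of B 1]
      by (auto simp: A_def B_def norm_minus_commute)
    have eq: "real n ^ r * cmod A = real n ^ s * cmod B"
      using arg_cong[OF AB, of cmod] by (simp add: norm_mult norm_power)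
    have strict: False if "i < j" "real n ^ i * x = real n ^ j * y" "x \<le> 5/4" "3/4 \<le> y" for i j x y
    proof -
      have "real n ^ i * 2 \<le> real n ^ Suc i" using n_ge_2 by (simp add: mult.commute)
      also have "\<dots> \<le> real n ^ j" using n_ge_2 that(1) by (intro power_increasing) auto
      finally have "real n ^ i * 2 * (3/4) \<le> real n ^ j * y"
        using that(4) by (intro mult_mono) auto
      also have "\<dots> \<le> real n ^ i * (5/4)"
        unfolding that(2)[symmetric] using that(3) by (intro mult_left_mono) auto
      finally show False using n_ge_2 by simp
    qed
    have "r = s"
      using strict[OF _ eq b(2,3)] strict[OF _ eq[symmetric] b(4,1)] by (metis linorder_neqE_nat)
    then have "q \<in> core" using q(1) homogeneous_0_in_core by simp
    moreover have "norm (w - q) < e" using q(2) by (simp add: d_def)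
    ultimately show ?thesis by blast
  qed
  then have "w \<in> closure core"
    by (simp add: closure_approachable dist_norm norm_minus_commute)
  then show ?thesis using closed_core by simp
qed

section \<open>Extensions give limits of the cocycle\<close>

lemma implementing_unitary:
  assumes \<rho>: "unital_star_hom_on UNIV \<rho>"
  obtains w where "unitary w" "\<And>i. i \<in> {1..n} \<Longrightarrow> \<rho> (S i) = w * S i"
proof
  define w where "w = (\<Sum>i=1..n. \<rho> (S i) * star (S i))"
  note \<rho>s = unital_star_hom_simps[OF \<rho>]
  show wS: "\<rho> (S i) = w * S i" if i: "i \<in> {1..n}" for i
  proof -
    have "w * S i = (\<Sum>j=1..n. if j = i then \<rho> (S j) else 0)"
      unfolding w_def sum_distrib_right using i by (intro sum.cong) (auto simp: mult.assoc star_S_S)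
    then show ?thesis using i by simp
  qed
  have "star w * w = 1"
  proof (rule matrix_eqI)
    fix i j assume ij: "i \<in> {1..n}" "j \<in> {1..n}"
    have "star (S i) * (star w * w) * S j = star (w * S i) * (w * S j)"
      by (simp add: star_mult mult.assoc)
    also have "\<dots> = \<rho> (star (S i) * S j)"
      using wS[OF ij(1)] wS[OF ij(2)] by (simp add: \<rho>s)
    finally show "star (S i) * (star w * w) * S j = star (S i) * 1 * S j"
      using star_S_S[OF ij] by (simp add: \<rho>s split: if_splits)
  qed
  moreover have "w * star w = 1"
  proof -
    have "w * star w = w * (\<Sum>i=1..n. S i * star (S i)) * star w"
      by (simp add: sum_range_projections)
    also have "\<dots> = (\<Sum>i=1..n. (w * S i) * star (w * S i))"
      by (simp add: sum_distrib_left sum_distrib_right star_mult mult.assoc)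
    also have "\<dots> = (\<Sum>i=1..n. \<rho> (S i) * star (\<rho> (S i)))"
      by (intro sum.cong) (simp_all add: wS)
    also have "\<dots> = \<rho> (\<Sum>i=1..n. S i * star (S i))"
      by (simp add: \<rho>s)
    finally show ?thesis by (simp add: sum_range_projections \<rho>s)
  qed
  ultimately show "unitary w" by (simp add: unitary_def)
qed

text \<open>For \<open>X\<close> in \<open>F (Suc k)\<close>, evaluate \<open>\<rho> X\<close> in
  two ways: directly as conjugation by \<open>U u (Suc k)\<close>, and through its entries in
  \<open>F k\<close>, where \<rho> conjugates by \<open>U u k\<close> and each \<open>S i\<close>
  contributes \<open>w\<close>. Moving \<open>U u k\<close> past \<open>S i\<close> turns it into
  \<open>V\<close>; substituting \<open>X = star V * x * V\<close> gives the claim.\<close>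

lemma conjugate_eq_cocycle_conjugate:
  assumes u: "unitary_seq u" and \<rho>: "unital_star_hom_on UNIV \<rho>"
    and \<rho>\<alpha>: "\<And>x. x \<in> core \<Longrightarrow> \<rho> x = \<alpha> u x"
    and w: "unitary w" "\<And>i. i \<in> {1..n} \<Longrightarrow> \<rho> (S i) = w * S i"
    and x: "x \<in> F (Suc k)"
  shows "w * x * star w = cocycle u k * x * star (cocycle u k)"
proof -
  note \<rho>s = unital_star_hom_simps[OF \<rho>]
  define V where "V = \<phi> (U u k)"
  have V: "V \<in> F (Suc k)" "V * star V = 1" "star V * V = 1"
    using fin_core_shift[OF elem_tensor_in_fin_core[OF u]] unitary_shift_power[OF unitary_elem_tensor[OF u, of k], of 1]
    by (auto simp: V_def unitary_def One_nat_def)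
  have main: "w * (V * X * star V) * star w = U u (Suc k) * X * star (U u (Suc k))" if X: "X \<in> F (Suc k)" for X
  proof -
    have entry: "\<rho> (S i * (star (S i) * X * S j) * star (S j))
      = w * (V * (S i * (star (S i) * X * S j) * star (S j)) * star V) * star w"
      if ij: "i \<in> {1..n}" "j \<in> {1..n}" for i j
    proof -
      define y where "y = star (S i) * X * S j"
      have y: "y \<in> F k" using X ij by (simp add: y_def fin_core_Suc_iff)
      have "\<rho> (S i * y * star (S j)) = w * (S i * U u k) * y * star (w * (S j * U u k))"
        using ij w(2) \<rho>\<alpha>[OF fin_core_subset_core[OF y]] \<alpha>_fin_core[OF u y]
        by (simp add: \<rho>s star_mult mult.assoc)
      also have "\<dots> = w * (V * S i) * y * star (w * (V * S j))"
        using ij by (simp add: V_def shift_mult_S)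
      finally show ?thesis by (simp add: y_def star_mult mult.assoc)
    qed
    have "\<rho> X = (\<Sum>i=1..n. \<Sum>j=1..n. \<rho> (S i * (star (S i) * X * S j) * star (S j)))"
      by (subst matrix_expansion[of X]) (simp only: \<rho>s(7))
    also have "\<dots> = (\<Sum>i=1..n. \<Sum>j=1..n. w * (V * (S i * (star (S i) * X * S j) * star (S j)) * star V) * star w)"
      by (intro sum.cong refl entry) auto
    also have "\<dots> = w * (V * (\<Sum>i=1..n. \<Sum>j=1..n. S i * (star (S i) * X * S j) * star (S j)) * star V) * star w"
      by (simp only: sum_distrib_left sum_distrib_right)
    also have "\<dots> = w * (V * X * star V) * star w"
      by (simp only: matrix_expansion[of X, symmetric])
    finally show ?thesis
      using \<rho>\<alpha>[OF fin_core_subset_core[OF X]] \<alpha>_fin_core[OF u X] by simp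
  qed
  have X: "star V * x * V \<in> F (Suc k)" using V x by (simp add: fin_core_mult fin_core_star)
  have "V * (star V * x * V) * star V = (V * star V) * x * (V * star V)" by (simp only: mult.assoc)
  then have "w * x * star w = w * (V * (star V * x * V) * star V) * star w" by (simp add: V)
  also have "\<dots> = U u (Suc k) * (star V * x * V) * star (U u (Suc k))" by (rule main[OF X])
  finally show ?thesis
    by (simp add: cocycle_eq[OF u] V_def star_mult star_star mult.assoc)
qed

lemma commute_if_conjugates_eq:
  assumes c: "unitary c" and w: "unitary w" and eq: "w * x * star w = c * x * star c"
  shows "star c * w * x = x * (star c * w)"
proof -
  have "star c * w * x = star c * (w * x * star w) * w"
    using w by (simp add: unitary_def mult.assoc)
  also have "\<dots> = (star c * c) * x * (star c * w)"
    unfolding eq by (simp only: mult.assoc)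
  finally show ?thesis using c by (simp add: unitary_def)
qed

text \<open>The cocycles and \<open>x\<close> are fixed by the gauge action, so
  \<open>gauge z w\<close> and \<open>w\<close> implement the same map on every \<open>F k\<close>.
  They differ by an element of the commutant of the core, that is, by a scalar, and
  \<open>eigenvector_in_core\<close> applies.\<close>

lemma implementing_unitary_in_core:
  assumes u: "unitary_seq u" and w: "unitary w"
    and conj: "\<And>k x. x \<in> F (Suc k) \<Longrightarrow> w * x * star w = cocycle u k * x * star (cocycle u k)"
  shows "w \<in> core"
proof (rule eigenvector_in_core[OF w])
  fix z assume z: "cmod z = 1"
  note g = unital_star_hom_simps[OF gauge(1)[OF z]]
  have gw: "unitary (gauge z w)" using w unfolding unitary_def by (simp flip: g(3,5) add: g(1))
  define h where "h = star w * gauge z w"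
  have "h * x = x * h" if "x \<in> F k" for k x
    unfolding h_def
  proof (rule commute_if_conjugates_eq[OF w gw])
    have x: "x \<in> F (Suc k)" by (rule fin_core_mono_Suc[OF that])
    have "gauge z w * x * star (gauge z w) = gauge z (w * x * star w)"
      by (simp add: g gauge_fin_core[OF z x])
    also have "\<dots> = w * x * star w"
      unfolding conj[OF x]
      by (rule gauge_fin_core[OF z, of _ "Suc k"]) (intro fin_core_mult fin_core_star cocycle_in_fin_core[OF u] x)
    finally show "gauge z w * x * star (gauge z w) = w * x * star w" .
  qed
  then have h: "h = \<omega> h *\<^sub>C 1" by (rule core_commutant)
  have "gauge z w = w * h"
    using w by (simp add: h_def unitary_def flip: mult.assoc)
  also have "\<dots> = \<omega> h *\<^sub>C w" by (subst h) (simp add: mult_scaleC_right)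
  finally have eq: "gauge z w = \<omega> h *\<^sub>C w" .
  moreover have "cmod (\<omega> h) = 1"
    using norm_unitary[OF gw] norm_unitary[OF w] unfolding eq by (simp add: norm_scaleC)
  ultimately show "\<exists>\<mu>. cmod \<mu> = 1 \<and> gauge z w = \<mu> *\<^sub>C w" by blast
qed

text \<open>Applying \<open>(\<psi> ^^ k)\<close> turns \<open>p\<close> into a scalar
  \<open>s\<close>, while the k-fold shift recovers \<open>g\<close> from
  \<open>(\<psi> ^^ k) g\<close>; so \<open>g\<close> is at least as close to \<open>s\<close> as to
  \<open>p\<close>. Replacing \<open>s\<close> by \<open>\<omega> g\<close> at most doubles the
  error.\<close>

lemma commutant_approx_scalar:
  assumes comm: "\<And>x. x \<in> F k \<Longrightarrow> g * x = x * g" and p: "p \<in> F k"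
  shows "norm (g - \<omega> g *\<^sub>C 1) \<le> 2 * norm (g - p)"
proof -
  have "(\<psi> ^^ k) p \<in> F 0" using p by (intro \<psi>_power_fin_core) simp
  then obtain s where s: "(\<psi> ^^ k) p = s *\<^sub>C 1" by (auto simp: fin_core_0)
  have "g + (- s) *\<^sub>C 1 = (\<phi> ^^ k) ((\<psi> ^^ k) g + (- s) *\<^sub>C 1)"
    unfolding shift_power_simps(2,4,1) by (simp add: shift_\<psi>_commutant[OF comm])
  also have "(\<psi> ^^ k) g + (- s) *\<^sub>C 1 = (\<psi> ^^ k) (g - p)"
    by (simp add: \<psi>_power_diff s)
  also have "norm ((\<phi> ^^ k) ((\<psi> ^^ k) (g - p))) \<le> norm (g - p)"
    by (rule order_trans[OF norm_shift_power_le norm_\<psi>_power_le])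
  finally have gs: "norm (g - s *\<^sub>C 1) \<le> norm (g - p)" by simp
  have "cmod (\<omega> g - s) \<le> norm (g - s *\<^sub>C 1)"
    using norm_\<omega>_le[of "g - s *\<^sub>C 1"] by (simp add: \<omega>_diff \<omega>_scale \<omega>_one)
  moreover have "norm (g - \<omega> g *\<^sub>C 1) \<le> norm (g - s *\<^sub>C 1) + cmod (\<omega> g - s)"
  proof -
    have "g - \<omega> g *\<^sub>C 1 = (g - s *\<^sub>C 1) - (\<omega> g - s) *\<^sub>C 1"
      by (simp add: cvec.scale_left_diff_distrib)
    also have "norm \<dots> \<le> norm (g - s *\<^sub>C 1) + norm ((\<omega> g - s) *\<^sub>C (1 :: 'a))"
      by (rule norm_triangle_ineq4)
    finally show ?thesis by (simp add: norm_scaleC)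
  qed
  ultimately show ?thesis using gs by simp
qed

text \<open>As \<open>g\<close> has norm one, the modulus of \<open>c\<close> differs from 1 by at
  most the distance from \<open>g\<close> to the scalar \<open>c\<close>. Normalizing
  \<open>c\<close> to its phase therefore at most doubles the distance.\<close>

lemma phase_approx:
  assumes "norm g = 1"
  shows "norm (exp (\<i> * complex_of_real (Arg c)) *\<^sub>C 1 - g) \<le> 2 * norm (g - c *\<^sub>C (1 :: 'a))"
proof -
  define t where "t = exp (\<i> * complex_of_real (Arg c))"
  have ct: "c = complex_of_real (cmod c) * t"
    using rcis_cmod_Arg[of c] by (simp add: t_def rcis_def cis_conv_exp)
  have t: "cmod t = 1" by (simp add: t_def)
  have "t *\<^sub>C 1 - g = (c *\<^sub>C 1 - g) + (complex_of_real (1 - cmod c) * t) *\<^sub>C 1"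
    using ct by (simp add: algebra_simps cvec.scale_left_diff_distrib)
  also have "norm \<dots> \<le> norm (g - c *\<^sub>C 1) + \<bar>1 - cmod c\<bar>"
    by (intro norm_triangle_mono)
      (simp_all add: norm_scaleC norm_mult t norm_minus_commute del: of_real_diff)
  also have "\<bar>1 - cmod c\<bar> \<le> norm (g - c *\<^sub>C 1)"
    using norm_triangle_ineq3[of g "c *\<^sub>C 1"] assms by (simp add: norm_scaleC)
  finally show ?thesis by (simp add: t_def)
qed

text \<open>The phases accumulate to a product in \<open>U u k\<close>, and the quotient of
  consecutive products is the last phase. Each cocycle can thus be corrected by a phase of its
  own.\<close>

lemma cocycle_phase:
  assumes u: "unitary_seq u" and t: "\<And>k. cmod (t k) = 1"
  shows "cocycle (\<lambda>k. t k *\<^sub>C u k) k = t (Suc k) *\<^sub>C cocycle u k"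
proof -
  have tt: "t k * cnj (t k) = 1" "cnj (t k) * t k = 1" for k
    using t[of k] complex_norm_square[of "t k"] by (simp_all add: mult.commute)
  have u': "unitary_seq (\<lambda>k. t k *\<^sub>C u k)"
    using u by (simp add: unitary_seq_def fin_core_scale unitary_def star_scaleC mult_scaleC_left
        mult_scaleC_right scaleC_scaleC tt scaleC_one)
  define P where "P k = (\<Prod>j<k. t (Suc j))" for k
  have UP: "U (\<lambda>k. t k *\<^sub>C u k) k = P k *\<^sub>C U u k" for k
    by (induction k) (simp_all add: P_def elem_tensor_0 elem_tensor_Suc scaleC_one shift_power_simps
        mult_scaleC_left mult_scaleC_right scaleC_scaleC mult.commute)
  have "P k * cnj (P k) = 1" for k
    by (induction k) (use tt in \<open>simp_all add: P_def mult_ac\<close>)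
  then have PP: "P (Suc k) * cnj (P k) = t (Suc k)" for k
    by (simp add: P_def mult_ac)
  show ?thesis
    by (simp add: cocycle_eq[OF u] cocycle_eq[OF u'] UP shift_simps star_scaleC mult_scaleC_left
        mult_scaleC_right scaleC_scaleC PP mult.commute[of "cnj (P k)"])
qed

theorem extension_cocycle_limit:
  assumes u: "unitary_seq u" and \<rho>: "unital_star_hom_on UNIV \<rho>"
    and ext: "\<And>x. x \<in> core \<Longrightarrow> \<rho> x = product_automorphism n S u x"
  obtains \<theta> :: "nat \<Rightarrow> real" and w where "w \<in> core"
    "cocycle (\<lambda>k. exp (\<i> * complex_of_real (\<theta> k)) *\<^sub>C u k) \<longlonglongrightarrow> w"
proof -
  have \<rho>\<alpha>: "\<rho> x = \<alpha> u x" if "x \<in> core" for x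
    using ext[OF that] product_automorphism_eq_\<alpha>[OF u that] by simp
  obtain w where w: "unitary w" "\<And>i. i \<in> {1..n} \<Longrightarrow> \<rho> (S i) = w * S i"
    using implementing_unitary[OF \<rho>] by blast
  have conj: "w * x * star w = cocycle u k * x * star (cocycle u k)" if "x \<in> F (Suc k)" for x k
    by (rule conjugate_eq_cocycle_conjugate[OF u \<rho> \<rho>\<alpha> w that])
  have wc: "w \<in> core" by (rule implementing_unitary_in_core[OF u w(1) conj])
  define g where "g k = star (cocycle u k) * w" for k
  note uc = unitary_cocycle[OF u]
  have comm: "g k * x = x * g k" if "x \<in> F (Suc k)" for k x
    unfolding g_def by (rule commute_if_conjugates_eq[OF uc w(1) conj[OF that]])
  have g1: "norm (g k) = 1" for k
    unfolding g_def by (intro norm_unitary unitary_mult unitary_star uc w(1))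
  \<comment> \<open>The k-th cocycle receives the phase with index \<open>Suc k\<close>, so the
    correction read off from \<open>g k\<close> is stored one place later.\<close>
  define \<theta> where "\<theta> k = Arg (\<omega> (g (k - 1)))" for k
  have "cocycle (\<lambda>k. exp (\<i> * complex_of_real (\<theta> k)) *\<^sub>C u k) \<longlonglongrightarrow> w"
  proof (rule LIMSEQ_I)
    fix e :: real assume "e > 0"
    \<comment> \<open>\<open>commutant_approx_scalar\<close> and \<open>phase_approx\<close> each
      double the error.\<close>
    then have "e / 4 > 0" by simp
    then obtain m p where p: "p \<in> F m" "norm (w - p) < e / 4"
      using core_approx[OF wc] by blast
    have "norm (cocycle (\<lambda>k. exp (\<i> * complex_of_real (\<theta> k)) *\<^sub>C u k) k - w) < e" if "k \<ge> m" for k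
    proof -
      have "star (cocycle u k) * p \<in> F (Suc k)"
        using fin_core_mono[of m "Suc k" p] p(1) that
        by (intro fin_core_mult fin_core_star cocycle_in_fin_core[OF u]) auto
      then have "norm (g k - \<omega> (g k) *\<^sub>C 1) \<le> 2 * norm (g k - star (cocycle u k) * p)"
        by (rule commutant_approx_scalar[rotated]) (rule comm)
      also have "g k - star (cocycle u k) * p = star (cocycle u k) * (w - p)"
        by (simp add: g_def algebra_simps)
      also have "norm \<dots> = norm (w - p)"
        by (rule norm_unitary_mult_left[OF unitary_star[OF uc]])
      finally have gk: "norm (g k - \<omega> (g k) *\<^sub>C 1) < e / 2" using p(2) by simp
      define t where "t = exp (\<i> * complex_of_real (\<theta> (Suc k)))"
      have "cocycle (\<lambda>k. exp (\<i> * complex_of_real (\<theta> k)) *\<^sub>C u k) k - w = t *\<^sub>C cocycle u k - w"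
        unfolding t_def by (subst cocycle_phase[OF u]) simp_all
      also have "\<dots> = cocycle u k * (t *\<^sub>C 1 - g k)"
        using uc[of k] by (simp add: g_def right_diff_distrib mult_scaleC_right unitary_def flip: mult.assoc)
      also have "norm \<dots> = norm (t *\<^sub>C 1 - g k)"
        by (rule norm_unitary_mult_left[OF uc])
      also have "\<dots> \<le> 2 * norm (g k - \<omega> (g k) *\<^sub>C 1)"
        using phase_approx[OF g1[of k], of "\<omega> (g k)"] by (simp add: t_def \<theta>_def)
      finally show ?thesis using gk by simp
    qed
    then show "\<exists>M. \<forall>k\<ge>M. norm (cocycle (\<lambda>k. exp (\<i> * complex_of_real (\<theta> k)) *\<^sub>C u k) k - w) < e"
      by blast
  qed
  then show ?thesis using that wc by blast
qed

end

theorem theorem2p1: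
  fixes n :: nat and S u :: "nat \<Rightarrow> 'a :: cstar_algebra"
  assumes "n \<ge> 2"
    and "cuntz_algebra n S"
    and "\<forall>i\<ge>1. u i \<in> fin_core n S 1 \<and> unitary (u i)"
  shows
    "(\<forall>v\<in>uhf_core n S. cocycle_tensor n S u \<longlonglongrightarrow> v \<longrightarrow>
        unitary v \<and>
        star_automorphism_on UNIV (cuntz_endo n S v) \<and>
        (\<forall>x\<in>uhf_core n S. cuntz_endo n S v x = product_automorphism n S u x))
     \<and>
     ((\<exists>\<rho>. unital_star_hom_on UNIV \<rho> \<and> (\<forall>x\<in>uhf_core n S. \<rho> x = product_automorphism n S u x))
      \<longrightarrow>
      (\<exists>\<theta> :: nat \<Rightarrow> real. \<exists>w\<in>uhf_core n S.
         cocycle_tensor n S (\<lambda>k. exp (\<i> * complex_of_real (\<theta> k)) *\<^sub>C u k) \<longlonglongrightarrow> w))"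
proof -
  interpret cuntz n S using assms(1,2) by unfold_locales
  have u: "unitary_seq u" using assms(3) by (simp add: unitary_seq_def)
  show ?thesis
  proof (intro conjI ballI impI)
    fix v assume v: "v \<in> core" "cocycle u \<longlonglongrightarrow> v"
    show "unitary v" "star_automorphism_on UNIV (cuntz_endo n S v)"
      "\<And>x. x \<in> core \<Longrightarrow> cuntz_endo n S v x = product_automorphism n S u x"
      by (fact cocycle_limit_automorphism[OF u v(2,1)])+
  next
    assume "\<exists>\<rho>. unital_star_hom_on UNIV \<rho> \<and> (\<forall>x\<in>core. \<rho> x = product_automorphism n S u x)"
    then obtain \<rho> where \<rho>: "unital_star_hom_on UNIV \<rho>"
      "\<And>x. x \<in> core \<Longrightarrow> \<rho> x = product_automorphism n S u x" by blast
    show "\<exists>\<theta> :: nat \<Rightarrow> real. \<exists>w\<in>core.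
        cocycle (\<lambda>k. exp (\<i> * complex_of_real (\<theta> k)) *\<^sub>C u k) \<longlonglongrightarrow> w"
      using extension_cocycle_limit[OF u \<rho>] by metis
  qed
qed

end
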